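(* For each integer $d\ge 1$, consider $\mathbb{R}^d$ with the euclidean distance and the standard gaussian measure $\gamma^d$, $d\gamma^d(x) = (2\pi)^{-d/2} e^{-\|x\|_2^2/2}\,dx$, and let $A_r = A_{r,\gamma^d}$ ($r>0$) be the associated averaging operators. Then: (1) For every $r>0$, $\gamma^d$ does not satisfy a local comparability condition for the radius $r$. (2) For all $p\ge 1$, $$\sup_{r>0}\|A_r\|_{L^p(\gamma^d)\to L^p(\gamma^d)} \le \left( 2^{d-1}\sqrt{2\pi d} + \sqrt{\pi(d+1)}\left(\frac{2}{\sqrt3}\right)^{d+1}\right)^{1/p}.$$ (3) Thus, for every $\varepsilon>0$ and every $d$ large enough, for all $p \ge 1$, $$\sup_{r>0}\|A_r\|_{L^p(\gamma^d)\to L^p(\gamma^d)} \le (2+\varepsilon)^{d/p}.$$ (4) For every $p\in[1,\infty)$ and every $d$ sufficiently large, the weak type $(p,p)$ constant for the radius $\frac{\sqrt{3d-3}}{2}$ satisfies $$\left\|A_{\frac{\sqrt{3d-3}}{2}}\right\|_{L^p\to L^{p,\infty}} > 1.019^{d/p}.$$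
   Context: $\|x\|_2$ is the euclidean norm and $B(x,r)=\{y : d(x,y)<r\}$ denotes the open ball. A Borel measure $\mu$ on a metric space $(X,d)$ satisfies a local comparability condition for the radius $r$ if there exists a constant $C\in[1,\infty)$ such that for all $x,y\in X$ with $d(x,y)<r$ one has $\mu(B(x,r))\le C\mu(B(y,r))$. The averaging operator is $A_{r,\mu}g(x) = \frac{1}{\mu(B(x,r))}\int_{B(x,r)} g\,d\mu$, for $g$ locally integrable and $x$ with $\mu(B(x,r))>0$. For $1\le p<\infty$ and an operator $T$, $\|T\|_{L^p\to L^p}$ is the smallest $c$ with $\|Tg\|_{L^p(\mu)}\le c\|g\|_{L^p(\mu)}$ for all $g\in L^p(\mu)$, and $\|T\|_{L^p\to L^{p,\infty}}$ is the smallest $c$ such that $\mu(\{Tg\ge\alpha\})\le \left(c\|g\|_{L^p(\mu)}/\alpha\right)^p$ for all $g\in L^p(\mu)$ and all $\alpha>0$. Here all norms are taken with respect to $\gamma^d$. *)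

theory Defs
  imports "HOL-Analysis.Analysis"
begin

text \<open>Since thresholds on the dimension occur inside the statement, \<open>\<real>\<^sup>d\<close> is represented by the
  carrier of the product measure space \<open>\<Pi>\<^sub>M i\<in>{..<d}. lborel\<close>, i.e. by functions
  \<^typ>\<open>nat \<Rightarrow> real\<close> that are \<^const>\<open>undefined\<close> outside \<open>{..<d}\<close>.\<close>

definition euclid_dist :: "nat \<Rightarrow> (nat \<Rightarrow> real) \<Rightarrow> (nat \<Rightarrow> real) \<Rightarrow> real" where
  "euclid_dist d x y = L2_set (\<lambda>i. x i - y i) {..<d}"

definition gauss_measure :: "nat \<Rightarrow> (nat \<Rightarrow> real) measure" where
  "gauss_measure d = density (\<Pi>\<^sub>M i\<in>{..<d}. lborel)
     (\<lambda>x. ennreal ((2 * pi) powr (- real d / 2) * exp (- (L2_set x {..<d})\<^sup>2 / 2)))"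

lemma space_gauss_measure: "space (gauss_measure d) = (\<Pi>\<^sub>E i\<in>{..<d}. UNIV)"
  by (simp add: gauss_measure_def space_PiM)

lemma Metric_space_gauss_measure: "Metric_space (space (gauss_measure d)) (euclid_dist d)"
proof
  fix x y z
  show "0 \<le> euclid_dist d x y"
    by (simp add: euclid_dist_def)
  show "euclid_dist d x y = euclid_dist d y x"
    by (simp add: euclid_dist_def L2_set_def power2_commute)
  show "euclid_dist d x y = 0 \<longleftrightarrow> x = y"
    if "x \<in> space (gauss_measure d)" "y \<in> space (gauss_measure d)"
    using that
    by (auto simp: euclid_dist_def L2_set_eq_0_iff space_gauss_measure intro: PiE_ext)
  show "euclid_dist d x z \<le> euclid_dist d x y + euclid_dist d y z"
    using L2_set_triangle_ineq[of "\<lambda>i. x i - y i" "\<lambda>i. y i - z i" "{..<d}"]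
    by (simp add: euclid_dist_def)
qed

text \<open>In the following, \<open>M\<close> is a Borel measure on the metric space \<open>(space M, dst)\<close>.\<close>

abbreviation oball :: "'a measure \<Rightarrow> ('a \<Rightarrow> 'a \<Rightarrow> real) \<Rightarrow> 'a \<Rightarrow> real \<Rightarrow> 'a set" where
  "oball M dst \<equiv> Metric_space.mball (space M) dst"

definition local_comparability :: "'a measure \<Rightarrow> ('a \<Rightarrow> 'a \<Rightarrow> real) \<Rightarrow> real \<Rightarrow> bool" where
  "local_comparability M dst r \<longleftrightarrow>
     (\<exists>C::real. C \<ge> 1 \<and> (\<forall>x\<in>space M. \<forall>y\<in>space M. dst x y < r \<longrightarrow>
        emeasure M (oball M dst x r) \<le> ennreal C * emeasure M (oball M dst y r)))"

definition averaging ::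
  "'a measure \<Rightarrow> ('a \<Rightarrow> 'a \<Rightarrow> real) \<Rightarrow> real \<Rightarrow> ('a \<Rightarrow> real) \<Rightarrow> 'a \<Rightarrow> real" where
  "averaging M dst r g x =
     1 / measure M (oball M dst x r) * (LINT y:oball M dst x r|M. g y)"

definition Lp_space :: "real \<Rightarrow> 'a measure \<Rightarrow> ('a \<Rightarrow> real) set" where
  "Lp_space p M = {g \<in> borel_measurable M. integrable M (\<lambda>x. \<bar>g x\<bar> powr p)}"

text \<open>Only meaningful on \<^const>\<open>Lp_space\<close>: elsewhere the Bochner integral defaults to 0.\<close>

definition Lp_norm :: "real \<Rightarrow> 'a measure \<Rightarrow> ('a \<Rightarrow> real) \<Rightarrow> real" where
  "Lp_norm p M g = (LINT x|M. \<bar>g x\<bar> powr p) powr (1 / p)"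

text \<open>Operator norms are extended nonnegative reals, \<open>\<infinity>\<close> if there is no admissible constant.
  The strong norm demands \<open>T g \<in> L\<^sup>p\<close> explicitly because of the default value above.\<close>

definition strong_norm :: "real \<Rightarrow> 'a measure \<Rightarrow> (('a \<Rightarrow> real) \<Rightarrow> 'a \<Rightarrow> real) \<Rightarrow> ennreal" where
  "strong_norm p M T = Inf {ennreal c |c. c \<ge> 0 \<and>
     (\<forall>g\<in>Lp_space p M. T g \<in> Lp_space p M \<and> Lp_norm p M (T g) \<le> c * Lp_norm p M g)}"

definition weak_norm :: "real \<Rightarrow> 'a measure \<Rightarrow> (('a \<Rightarrow> real) \<Rightarrow> 'a \<Rightarrow> real) \<Rightarrow> ennreal" where
  "weak_norm p M T = Inf {ennreal c |c. c \<ge> 0 \<and>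
     (\<forall>g\<in>Lp_space p M. \<forall>\<alpha>>0.
        emeasure M {x \<in> space M. T g x \<ge> \<alpha>} \<le> ennreal ((c * Lp_norm p M g / \<alpha>) powr p))}"

abbreviation gauss_avg :: "nat \<Rightarrow> real \<Rightarrow> ((nat \<Rightarrow> real) \<Rightarrow> real) \<Rightarrow> (nat \<Rightarrow> real) \<Rightarrow> real" where
  "gauss_avg d \<equiv> averaging (gauss_measure d) (euclid_dist d)"

end

theory Submission
  imports Defs "HOL-Probability.Distributions"
begin

text \<open>By Jensen and Fubini the \<open>L\<^sup>p\<close> norm of \<open>A\<^sub>r\<close> is at most \<open>K\<^bsup>1/p\<^esup>\<close>, where \<open>K\<close> bounds
  \<open>\<integral>\<^bsub>B(y, r)\<^esub> d\<gamma>(x) / \<gamma>(B(x, r))\<close> for all \<open>y\<close>; a comparison of volumes gives \<open>K = 2\<^sup>d + 1\<close>, which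
  is less than the constants in parts (2) and, for large \<open>d\<close>, (3).

  For the weak type bound, test \<open>A\<^sub>r\<close> on the indicator of a ball \<open>B(0, \<rho>)\<close>. If \<open>x\<close> lies in a thin shell
  about the origin of suitable radius, then \<open>\<gamma>\<close> conditioned on \<open>B(x, r)\<close> concentrates near a norm
  smaller than \<open>\<rho>\<close>, so \<open>A\<^sub>r\<close> is at least \<open>1/2\<close> on the whole shell, while the shell has
  exponentially larger measure than \<open>B(0, \<rho>)\<close>. All these estimates are Chernoff bounds: the
  exponential moments of \<open>\<parallel>z\<parallel>\<^sup>2\<close> and \<open>\<parallel>z - x\<parallel>\<^sup>2\<close> are products of one-dimensional Gaussian
  integrals, and the lower bounds follow from the upper ones by removing the tails.\<close>

section \<open>Balls and the Gaussian measure\<close>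

abbreviation lebesgue_PiM :: "nat \<Rightarrow> (nat \<Rightarrow> real) measure" where
  "lebesgue_PiM d \<equiv> \<Pi>\<^sub>M i\<in>{..<d}. lborel"

abbreviation gdens :: "nat \<Rightarrow> real \<Rightarrow> real" where
  "gdens d s \<equiv> (2 * pi) powr (- real d / 2) * exp (- s\<^sup>2 / 2)"

abbreviation gball :: "nat \<Rightarrow> (nat \<Rightarrow> real) \<Rightarrow> real \<Rightarrow> (nat \<Rightarrow> real) set" where
  "gball d \<equiv> oball (gauss_measure d) (euclid_dist d)"

lemma sets_gauss_measure [measurable_cong, simp]: "sets (gauss_measure d) = sets (lebesgue_PiM d)"
  by (simp add: gauss_measure_def)

lemma gball_eq:
  assumes "x \<in> space (lebesgue_PiM d)"
  shows "gball d x r = {y \<in> space (lebesgue_PiM d). euclid_dist d x y < r}"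
  using assms unfolding Metric_space.mball_def[OF Metric_space_gauss_measure]
  by (simp add: space_gauss_measure space_PiM)

lemma measurable_L2_set_PiM [measurable]:
  "(\<lambda>x. L2_set x {..<d}) \<in> borel_measurable (lebesgue_PiM d)"
  unfolding L2_set_def by measurable

lemma measurable_euclid_dist:
  assumes [measurable]: "f \<in> M \<rightarrow>\<^sub>M lebesgue_PiM d" "g \<in> M \<rightarrow>\<^sub>M lebesgue_PiM d"
  shows "(\<lambda>x. euclid_dist d (f x) (g x)) \<in> borel_measurable M"
proof -
  have [measurable]: "(\<lambda>x. f x i) \<in> borel_measurable M" "(\<lambda>x. g x i) \<in> borel_measurable M"
    if "i < d" for i
    using that by (auto intro!: measurable_compose[OF assms(1)] measurable_compose[OF assms(2)])
  show ?thesis unfolding euclid_dist_def L2_set_def by measurable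
qed

lemma measurable_euclid_dist_left [measurable]:
  "euclid_dist d x \<in> borel_measurable (lebesgue_PiM d)"
  unfolding euclid_dist_def L2_set_def by measurable

lemma gball_measurable [measurable]:
  assumes "x \<in> space (lebesgue_PiM d)"
  shows "gball d x r \<in> sets (lebesgue_PiM d)"
  using assms unfolding gball_eq[OF assms] by measurable

lemma euclid_dist_nonneg: "0 \<le> euclid_dist d x y"
  by (simp add: euclid_dist_def)

lemma euclid_dist_commute: "euclid_dist d x y = euclid_dist d y x"
  by (simp add: euclid_dist_def L2_set_def power2_commute)

lemma euclid_dist_triangle: "euclid_dist d x z \<le> euclid_dist d x y + euclid_dist d y z"
  using L2_set_triangle_ineq[of "\<lambda>i. x i - y i" "\<lambda>i. y i - z i" "{..<d}"]
  by (simp add: euclid_dist_def)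

lemma L2_set_le_dist: "L2_set y {..<d} \<le> L2_set x {..<d} + euclid_dist d x y"
  using L2_set_triangle_ineq[of x "\<lambda>i. y i - x i" "{..<d}"]
  by (simp add: euclid_dist_commute[of d x y]) (simp add: euclid_dist_def)

lemma euclid_dist_scaled:
  "euclid_dist d (\<lambda>i\<in>{..<d}. a * v i) (\<lambda>i\<in>{..<d}. b * v i) = \<bar>a - b\<bar> * L2_set v {..<d}"
proof -
  have "euclid_dist d (\<lambda>i\<in>{..<d}. a * v i) (\<lambda>i\<in>{..<d}. b * v i)
      = L2_set (\<lambda>i. (a - b) * v i) {..<d}"
    unfolding euclid_dist_def by (intro L2_set_cong) (auto simp: left_diff_distrib)
  also have "\<dots> = \<bar>a - b\<bar> * L2_set v {..<d}"
    by (simp add: L2_set_def power_mult_distrib real_sqrt_mult flip: sum_distrib_left)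
  finally show ?thesis .
qed

lemma L2_set_scaled: "L2_set (\<lambda>i\<in>{..<d}. a * v i) {..<d} = \<bar>a\<bar> * L2_set v {..<d}"
proof -
  have "L2_set (\<lambda>i\<in>{..<d}. a * v i) {..<d} = L2_set (\<lambda>i. a * v i) {..<d}"
    by (intro L2_set_cong) auto
  also have "\<dots> = \<bar>a\<bar> * L2_set v {..<d}"
    by (simp add: L2_set_def power_mult_distrib real_sqrt_mult flip: sum_distrib_left)
  finally show ?thesis .
qed

abbreviation origin :: "nat \<Rightarrow> nat \<Rightarrow> real" where
  "origin d \<equiv> \<lambda>i\<in>{..<d}. 0"

lemma origin_in_space: "origin d \<in> space (lebesgue_PiM d)"
  by (auto simp: space_PiM)

lemma euclid_dist_origin: "euclid_dist d (origin d) x = L2_set x {..<d}"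
  by (simp add: euclid_dist_def L2_set_def)

lemma L2_set_origin_sq: "(L2_set (origin d) {..<d})\<^sup>2 = 0 * real d"
  by (simp add: L2_set_def)

lemma restrict_id_PiM: "x \<in> space (lebesgue_PiM d) \<Longrightarrow> (\<lambda>i\<in>{..<d}. 1 * x i) = x"
  by (auto simp: space_PiM PiE_def extensional_def restrict_def)

section \<open>Scaling of Lebesgue measure and the volume of balls\<close>

lemma lborel_affine_preimage:
  assumes "a > 0" "A \<in> sets borel"
  shows "ennreal a * emeasure lborel {t. c + a * t \<in> A} = emeasure lborel A"
proof -
  have [measurable]: "A \<in> sets borel" by fact
  have "emeasure lborel A = emeasure (density (distr lborel borel (\<lambda>x. c + a * x)) (\<lambda>_. ennreal \<bar>a\<bar>)) A"
    using lborel_real_affine[of a c] assms by simp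
  also have "\<dots> = ennreal a * emeasure (distr lborel borel (\<lambda>x. c + a * x)) A"
    using assms by (subst emeasure_density_const) auto
  also have "\<dots> = ennreal a * emeasure lborel {t. c + a * t \<in> A}"
    by (subst emeasure_distr) (auto intro!: arg_cong2[where f="(*)"] arg_cong[where f="emeasure lborel"])
  finally show ?thesis ..
qed

text \<open>A product measure is determined by its values on boxes, and the preimage of a box under
  this coordinatewise map is again a box, so the change of variables reduces to dimension
  one.\<close>

lemma lebesgue_PiM_affine:
  assumes "a > 0"
  shows "density (distr (lebesgue_PiM d) (lebesgue_PiM d) (\<lambda>z. \<lambda>i\<in>{..<d}. c i + a * z i))
           (\<lambda>_. ennreal (a ^ d)) = lebesgue_PiM d" (is "density (distr _ _ ?f) _ = _")
proof -
  interpret product_sigma_finite "\<lambda>_::nat. lborel :: real measure" by standard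
  have [measurable]: "?f \<in> lebesgue_PiM d \<rightarrow>\<^sub>M lebesgue_PiM d"
    by measurable
  show ?thesis
  proof (rule PiM_eqI)
    fix A :: "nat \<Rightarrow> real set" assume A: "\<And>i. i \<in> {..<d} \<Longrightarrow> A i \<in> sets lborel"
    then have [measurable]: "Pi\<^sub>E {..<d} A \<in> sets (lebesgue_PiM d)"
      by (intro sets_PiM_I_finite) auto
    have pre: "?f -` Pi\<^sub>E {..<d} A \<inter> space (lebesgue_PiM d) = (\<Pi>\<^sub>E i\<in>{..<d}. {t. c i + a * t \<in> A i})"
      by (auto simp: space_PiM PiE_def Pi_def)
    have m: "{t. c i + a * t \<in> A i} \<in> sets borel" if "i < d" for i
    proof -
      have [measurable]: "A i \<in> sets borel" using A[of i] that by simp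
      show ?thesis by measurable
    qed
    have "emeasure (density (distr (lebesgue_PiM d) (lebesgue_PiM d) ?f) (\<lambda>_. ennreal (a ^ d))) (Pi\<^sub>E {..<d} A)
       = ennreal (a ^ d) * emeasure (lebesgue_PiM d) (\<Pi>\<^sub>E i\<in>{..<d}. {t. c i + a * t \<in> A i})"
      by (subst emeasure_density_const) (auto simp: emeasure_distr pre)
    also have "\<dots> = (\<Prod>i<d. ennreal a) * (\<Prod>i<d. emeasure lborel {t. c i + a * t \<in> A i})"
      using assms m by (subst emeasure_PiM) (auto simp: ennreal_power)
    also have "\<dots> = (\<Prod>i<d. emeasure lborel (A i))"
      unfolding prod.distrib[symmetric] using A assms
      by (intro prod.cong refl lborel_affine_preimage) auto
    finally show "emeasure (density (distr (lebesgue_PiM d) (lebesgue_PiM d) ?f) (\<lambda>_. ennreal (a ^ d))) (Pi\<^sub>E {..<d} A)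
      = (\<Prod>i<d. emeasure lborel (A i))" .
  qed auto
qed

text \<open>Kept abstract: the constant cancels in every quotient of volumes, so finiteness and
  positivity suffice.\<close>

definition ball_vol :: "nat \<Rightarrow> real" where
  "ball_vol d = measure (lebesgue_PiM d) {z \<in> space (lebesgue_PiM d). L2_set z {..<d} < 1}"

text \<open>The open unit ball lies between the closed balls of radii 1/2 and 1, whose volumes are
  known, finite and positive.\<close>

lemma emeasure_unit_ball:
  "emeasure (lebesgue_PiM d) {z \<in> space (lebesgue_PiM d). L2_set z {..<d} < 1} = ennreal (ball_vol d)"
  and ball_vol_pos: "ball_vol d > 0"
proof -
  let ?B = "{z \<in> space (lebesgue_PiM d). L2_set z {..<d} < 1}"
  let ?C = "\<lambda>r. {f. sqrt (\<Sum>i<d. (f i)\<^sup>2) \<le> r} \<inter> space (lebesgue_PiM d)"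
  have C: "?C r \<in> sets (lebesgue_PiM d)" for r
  proof -
    have "{z \<in> space (lebesgue_PiM d). L2_set z {..<d} \<le> r} \<in> sets (lebesgue_PiM d)" by measurable
    also have "{z \<in> space (lebesgue_PiM d). L2_set z {..<d} \<le> r} = ?C r" by (auto simp: L2_set_def)
    finally show ?thesis .
  qed
  have "emeasure (lebesgue_PiM d) ?B \<le> emeasure (lebesgue_PiM d) (?C 1)"
    by (intro emeasure_mono C) (auto simp: L2_set_def)
  also have "\<dots> < \<infinity>"
    by (subst emeasure_cball_aux) auto
  finally show "emeasure (lebesgue_PiM d) ?B = ennreal (ball_vol d)"
    unfolding ball_vol_def by (intro emeasure_eq_ennreal_measure) auto
  have "0 < emeasure (lebesgue_PiM d) (?C (1/2))"
    by (subst emeasure_cball_aux) auto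
  also have "\<dots> \<le> emeasure (lebesgue_PiM d) ?B"
    by (intro emeasure_mono) (auto simp: L2_set_def[symmetric])
  also have "\<dots> = ennreal (ball_vol d)" by fact
  finally show "ball_vol d > 0" by simp
qed

lemma emeasure_lebesgue_ball:
  assumes x: "x \<in> space (lebesgue_PiM d)" and r: "r > 0"
  shows "emeasure (lebesgue_PiM d) (gball d x r) = ennreal (r ^ d * ball_vol d)"
proof -
  let ?f = "\<lambda>z. \<lambda>i\<in>{..<d}. x i + r * z i"
  have [measurable]: "?f \<in> lebesgue_PiM d \<rightarrow>\<^sub>M lebesgue_PiM d" by measurable
  have d: "euclid_dist d x (?f z) = r * L2_set z {..<d}" for z
  proof -
    have "euclid_dist d x (?f z) = L2_set (\<lambda>i. r * (- z i)) {..<d}"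
      unfolding euclid_dist_def by (intro L2_set_cong) auto
    then show ?thesis using r
      by (simp add: L2_set_def power_mult_distrib real_sqrt_mult flip: sum_distrib_left)
  qed
  have pre: "?f -` gball d x r \<inter> space (lebesgue_PiM d)
    = {z \<in> space (lebesgue_PiM d). L2_set z {..<d} < 1}"
    unfolding gball_eq[OF x] using r
    by (auto simp: d) (auto simp: space_PiM)
  have "emeasure (lebesgue_PiM d) (gball d x r)
     = ennreal (r ^ d) * emeasure (distr (lebesgue_PiM d) (lebesgue_PiM d) ?f) (gball d x r)"
    using x by (subst lebesgue_PiM_affine[OF r, of d x, symmetric], subst emeasure_density_const)
       (auto intro: gball_measurable)
  also have "\<dots> = ennreal (r ^ d) * ennreal (ball_vol d)"
    using x by (subst emeasure_distr) (auto simp: pre emeasure_unit_ball intro: gball_measurable)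
  finally show ?thesis
    using r ball_vol_pos[of d] by (simp add: ennreal_mult)
qed

section \<open>Comparison of Gaussian and Lebesgue measure\<close>

text \<open>The density is radial and decreases with the norm, so a lower bound for the norm on
  \<open>A\<close> is an upper bound for the density there. The condition \<open>s \<ge> 0\<close>
  makes squaring monotone.\<close>

lemma gauss_measure_le:
  assumes [measurable]: "A \<in> sets (lebesgue_PiM d)" and "s \<ge> 0"
    and "\<And>z. z \<in> A \<Longrightarrow> s \<le> L2_set z {..<d}"
  shows "emeasure (gauss_measure d) A \<le> ennreal (gdens d s) * emeasure (lebesgue_PiM d) A"
proof -
  have "emeasure (gauss_measure d) A
      = (\<integral>\<^sup>+z. ennreal (gdens d (L2_set z {..<d})) * indicator A z \<partial>lebesgue_PiM d)"
    unfolding gauss_measure_def by (subst emeasure_density) auto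
  also have "\<dots> \<le> (\<integral>\<^sup>+z. ennreal (gdens d s) * indicator A z \<partial>lebesgue_PiM d)"
    using assms(2,3) by (intro nn_integral_mono)
      (auto simp: indicator_def intro!: ennreal_leI mult_left_mono power_mono)
  also have "\<dots> = ennreal (gdens d s) * emeasure (lebesgue_PiM d) A"
    by (simp add: nn_integral_cmult_indicator)
  finally show ?thesis .
qed

lemma gauss_measure_ge:
  assumes [measurable]: "A \<in> sets (lebesgue_PiM d)"
    and "\<And>z. z \<in> A \<Longrightarrow> L2_set z {..<d} \<le> s"
  shows "ennreal (gdens d s) * emeasure (lebesgue_PiM d) A \<le> emeasure (gauss_measure d) A"
proof -
  have "ennreal (gdens d s) * emeasure (lebesgue_PiM d) A
      = (\<integral>\<^sup>+z. ennreal (gdens d s) * indicator A z \<partial>lebesgue_PiM d)"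
    by (simp add: nn_integral_cmult_indicator)
  also have "\<dots> \<le> (\<integral>\<^sup>+z. ennreal (gdens d (L2_set z {..<d})) * indicator A z \<partial>lebesgue_PiM d)"
    using assms(2) by (intro nn_integral_mono)
      (auto simp: indicator_def intro!: ennreal_leI mult_left_mono power_mono)
  also have "\<dots> = emeasure (gauss_measure d) A"
    unfolding gauss_measure_def by (subst emeasure_density) auto
  finally show ?thesis .
qed

section \<open>Gaussian exponential moments\<close>

text \<open>Completing the square with \<open>m = 1 - l + k\<close> turns the integrand into a
  constant times the normal density of mean \<open>k * x / m\<close> and variance
  \<open>1 / m\<close>, which has total mass one.\<close>

lemma nn_integral_gauss_1D:
  fixes l k x :: real
  assumes m: "1 - l + k > 0"
  shows "(\<integral>\<^sup>+z. ennreal ((2 * pi) powr (- 1 / 2) * exp ((- z\<^sup>2 + l * z\<^sup>2 - k * (x - z)\<^sup>2) / 2)) \<partial>lborel)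
    = ennreal ((1 - l + k) powr (- 1 / 2) * exp ((k\<^sup>2 / (1 - l + k) - k) / 2 * x\<^sup>2))"
proof -
  define m where "m = 1 - l + k"
  have m0: "m > 0" using assms m_def by simp
  define C where "C = m powr (- 1 / 2) * exp ((k\<^sup>2 / m - k) / 2 * x\<^sup>2)"
  have eq: "(2 * pi) powr (- 1 / 2) * exp ((- z\<^sup>2 + l * z\<^sup>2 - k * (x - z)\<^sup>2) / 2)
    = C * normal_density (k * x / m) (1 / sqrt m) z" for z
  proof -
    have e1: "(- z\<^sup>2 + l * z\<^sup>2 - k * (x - z)\<^sup>2) / 2
      = (k\<^sup>2 / m - k) / 2 * x\<^sup>2 + (- (z - k * x / m)\<^sup>2 / (2 * (1 / sqrt m)\<^sup>2))"
    proof -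
      have "l = 1 + k - m" by (simp add: m_def)
      then show ?thesis using m0
        by (simp add: power_divide) (simp add: field_simps power2_eq_square)
    qed
    have e2: "(2 * pi) powr (- 1 / 2) = m powr (- 1 / 2) * (1 / sqrt (2 * pi * (1 / sqrt m)\<^sup>2))"
      using m0 by (simp add: powr_minus powr_half_sqrt power_divide real_sqrt_divide real_sqrt_mult field_simps)
    show ?thesis
      unfolding e1 e2 C_def normal_density_def exp_add by (simp add: mult_ac)
  qed
  interpret prob_space "density lborel (\<lambda>z. ennreal (normal_density (k * x / m) (1 / sqrt m) z))"
    using m0 by (intro prob_space_normal_density) auto
  have one: "(\<integral>\<^sup>+z. ennreal (normal_density (k * x / m) (1 / sqrt m) z) \<partial>lborel) = 1"
    using emeasure_space_1 by (simp add: emeasure_density)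
  have C0: "C \<ge> 0" by (simp add: C_def)
  show ?thesis
    unfolding eq m_def[symmetric] C_def[symmetric] using C0
    by (simp add: ennreal_mult nn_integral_cmult one)
qed

text \<open>The common source of all Chernoff bounds: \<open>l\<close> tilts by the norm of
  \<open>z\<close> and \<open>k\<close> by its distance to \<open>x\<close>. Both squares are sums
  over coordinates, so the integrand is a product and the integral factorises.\<close>

lemma gauss_chernoff:
  assumes m: "1 - l + k > 0"
  shows "(\<integral>\<^sup>+z. ennreal (exp ((l * (L2_set z {..<d})\<^sup>2 - k * (euclid_dist d x z)\<^sup>2) / 2)) \<partial>gauss_measure d)
    = ennreal ((1 - l + k) powr (- real d / 2) * exp ((k\<^sup>2 / (1 - l + k) - k) / 2 * (L2_set x {..<d})\<^sup>2))"
    (is "?L = _")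
proof -
  interpret product_sigma_finite "\<lambda>_::nat. lborel :: real measure" by standard
  let ?h = "\<lambda>i z. (2 * pi) powr (- 1 / 2) * exp ((- z\<^sup>2 + l * z\<^sup>2 - k * (x i - z)\<^sup>2) / 2)"
  have sq: "(L2_set f {..<d})\<^sup>2 = (\<Sum>i<d. (f i)\<^sup>2)" for f :: "nat \<Rightarrow> real"
    by (simp add: L2_set_def sum_nonneg)
  have pw: "(b powr (- 1 / 2)) ^ d = b powr (- real d / 2)" if "b > 0" for b :: real
    using that by (simp add: powr_power)
  have meas: "(\<lambda>z. exp ((l * (L2_set z {..<d})\<^sup>2 - k * (euclid_dist d x z)\<^sup>2) / 2)) \<in> borel_measurable (lebesgue_PiM d)"
    by measurable
  have eq: "gdens d (L2_set z {..<d}) * exp ((l * (L2_set z {..<d})\<^sup>2 - k * (euclid_dist d x z)\<^sup>2) / 2)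
     = (\<Prod>i<d. ?h i (z i))" for z
  proof -
    have "(\<Prod>i<d. ?h i (z i)) = ((2 * pi) powr (- 1 / 2)) ^ d * exp (\<Sum>i<d. (- (z i)\<^sup>2 + l * (z i)\<^sup>2 - k * (x i - z i)\<^sup>2) / 2)"
      by (simp add: prod.distrib exp_sum)
    also have "(\<Sum>i<d. (- (z i)\<^sup>2 + l * (z i)\<^sup>2 - k * (x i - z i)\<^sup>2) / 2)
      = - (L2_set z {..<d})\<^sup>2 / 2 + (l * (L2_set z {..<d})\<^sup>2 - k * (euclid_dist d x z)\<^sup>2) / 2"
      unfolding euclid_dist_def sq
      by (simp add: sum_distrib_left sum_subtractf sum.distrib sum_negf diff_divide_distrib add_divide_distrib flip: sum_divide_distrib)
    finally show ?thesis by (simp only: exp_add pw[of "2 * pi"] pi_gt_zero mult.assoc zero_less_mult_iff zero_less_numeral simp_thms)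
  qed
  have "?L = (\<integral>\<^sup>+z. ennreal (gdens d (L2_set z {..<d}) * exp ((l * (L2_set z {..<d})\<^sup>2 - k * (euclid_dist d x z)\<^sup>2) / 2)) \<partial>lebesgue_PiM d)"
    unfolding gauss_measure_def using meas
    by (subst nn_integral_density) (simp_all add: ennreal_mult)
  also have "\<dots> = (\<integral>\<^sup>+z. (\<Prod>i<d. ennreal (?h i (z i))) \<partial>lebesgue_PiM d)"
    unfolding eq by (simp add: prod_ennreal)
  also have "\<dots> = (\<Prod>i<d. (\<integral>\<^sup>+z. ennreal (?h i z) \<partial>lborel))"
    by (intro product_nn_integral_prod) auto
  also have "\<dots> = (\<Prod>i<d. ennreal ((1 - l + k) powr (- 1 / 2) * exp ((k\<^sup>2 / (1 - l + k) - k) / 2 * (x i)\<^sup>2)))"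
    by (intro prod.cong refl nn_integral_gauss_1D m)
  also have "\<dots> = ennreal (((1 - l + k) powr (- 1 / 2)) ^ d * exp (\<Sum>i<d. (k\<^sup>2 / (1 - l + k) - k) / 2 * (x i)\<^sup>2))"
    by (simp add: prod_ennreal prod.distrib exp_sum)
  also have "\<dots> = ennreal ((1 - l + k) powr (- real d / 2) * exp ((k\<^sup>2 / (1 - l + k) - k) / 2 * (L2_set x {..<d})\<^sup>2))"
    unfolding sq sum_distrib_left pw[OF m] ..
  finally show ?thesis .
qed

lemma prob_space_gauss_measure: "prob_space (gauss_measure d)"
proof
  show "emeasure (gauss_measure d) (space (gauss_measure d)) = 1"
    \<comment> \<open>For \<open>l = k = 0\<close> the exponential moment is the total mass.\<close>
    using gauss_chernoff[of 0 0 d "\<lambda>_. 0"] by simp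
qed

section \<open>Measurability and lower bounds for the Gaussian measure of balls\<close>

lemma nn_integral_gauss:
  assumes "f \<in> borel_measurable (lebesgue_PiM d)"
  shows "(\<integral>\<^sup>+x. f x \<partial>gauss_measure d) = (\<integral>\<^sup>+x. ennreal (gdens d (L2_set x {..<d})) * f x \<partial>lebesgue_PiM d)"
  unfolding gauss_measure_def using assms by (intro nn_integral_density) simp_all

text \<open>The balls are the sections of the set \<open>Q\<close> of pairs at distance less than
  \<open>r\<close>, and the measure of a section of a measurable set depends measurably on the base
  point.\<close>

lemma measurable_measure_gball [measurable]:
  "(\<lambda>x. measure (gauss_measure d) (gball d x r)) \<in> borel_measurable (lebesgue_PiM d)"
proof -
  interpret prob_space "gauss_measure d" by (rule prob_space_gauss_measure)
  define Q where "Q = {xy \<in> space (lebesgue_PiM d \<Otimes>\<^sub>M lebesgue_PiM d). euclid_dist d (fst xy) (snd xy) < r}"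
  have "(\<lambda>xy. euclid_dist d (fst xy) (snd xy)) \<in> borel_measurable (lebesgue_PiM d \<Otimes>\<^sub>M lebesgue_PiM d)"
    by (rule measurable_euclid_dist[OF measurable_fst measurable_snd])
  then have "Q \<in> sets (lebesgue_PiM d \<Otimes>\<^sub>M lebesgue_PiM d)"
    unfolding Q_def by (rule borel_measurable_less) simp
  also have "sets (lebesgue_PiM d \<Otimes>\<^sub>M lebesgue_PiM d) = sets (lebesgue_PiM d \<Otimes>\<^sub>M gauss_measure d)"
    by (intro sets_pair_measure_cong) simp_all
  finally have Q: "Q \<in> sets (lebesgue_PiM d \<Otimes>\<^sub>M gauss_measure d)" .
  have "Pair x -` Q = gball d x r" if "x \<in> space (lebesgue_PiM d)" for x
    unfolding gball_eq[OF that] Q_def using that by (simp add: space_pair_measure vimage_def)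
  then have "(\<lambda>x. measure (gauss_measure d) (gball d x r)) \<in> borel_measurable (lebesgue_PiM d)
    \<longleftrightarrow> (\<lambda>x. measure (gauss_measure d) (Pair x -` Q)) \<in> borel_measurable (lebesgue_PiM d)"
    by (intro measurable_cong) simp
  also have "\<dots>"
    unfolding measure_def using measurable_emeasure_Pair[OF Q] by simp
  finally show ?thesis .
qed

text \<open>An auxiliary ball \<open>B(c, s)\<close> inside \<open>B(x, r)\<close> gives the bound:
  moving \<open>c\<close> towards the origin raises the density at the cost of a smaller
  volume.\<close>

lemma gauss_measure_ball_ge:
  assumes x: "x \<in> space (lebesgue_PiM d)" and c: "c \<in> space (lebesgue_PiM d)"
    and sub: "gball d c s \<subseteq> gball d x r" and s: "s > 0" and t: "L2_set c {..<d} + s \<le> t"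
  shows "gdens d t * (s ^ d * ball_vol d) \<le> measure (gauss_measure d) (gball d x r)"
proof -
  interpret prob_space "gauss_measure d" by (rule prob_space_gauss_measure)
  have "ennreal (gdens d t * (s ^ d * ball_vol d)) = ennreal (gdens d t) * emeasure (lebesgue_PiM d) (gball d c s)"
    using s ball_vol_pos[of d] by (simp add: emeasure_lebesgue_ball[OF c] ennreal_mult)
  also have "\<dots> \<le> emeasure (gauss_measure d) (gball d c s)"
  proof (rule gauss_measure_ge)
    fix z assume "z \<in> gball d c s"
    then have "euclid_dist d c z < s" by (simp add: gball_eq[OF c])
    then show "L2_set z {..<d} \<le> t" using L2_set_le_dist[of z d c] t by linarith
  qed (rule gball_measurable[OF c])
  also have "\<dots> \<le> emeasure (gauss_measure d) (gball d x r)"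
    by (intro emeasure_mono sub) (simp add: gball_measurable x)
  finally show ?thesis
    by (simp add: emeasure_eq_measure)
qed

lemma measure_gball_pos:
  assumes x: "x \<in> space (lebesgue_PiM d)" and r: "r > 0"
  shows "0 < measure (gauss_measure d) (gball d x r)"
proof -
  have "0 < gdens d (L2_set x {..<d} + r) * (r ^ d * ball_vol d)"
    using r ball_vol_pos[of d] by simp
  also have "\<dots> \<le> measure (gauss_measure d) (gball d x r)"
    by (rule gauss_measure_ball_ge) (use x r in auto)
  finally show ?thesis .
qed

lemma gball_subset:
  assumes x: "x \<in> space (lebesgue_PiM d)" and c: "c \<in> space (lebesgue_PiM d)"
    and "euclid_dist d x c + s \<le> r"
  shows "gball d c s \<subseteq> gball d x r"
  using assms(3) euclid_dist_triangle[of d x _ c]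
  by (auto simp: gball_eq[OF x] gball_eq[OF c]) (smt (verit))

section \<open>Failure of local comparability\<close>

text \<open>Two centres at distance \<open>3 * r / 4\<close> are taken on a ray far from the origin.
  The inner ball contains a ball of radius \<open>r / 4\<close> on which norms are at most
  \<open>R - r / 2\<close>, whereas norms on the outer ball are at least \<open>R - r / 4\<close>.
  The quotient of the densities grows exponentially in \<open>R\<close>, the quotient of the volumes
  stays \<open>4 ^ d\<close>.\<close>

lemma not_local_comparability_gauss:
  assumes d: "d \<ge> 1" and r: "r > 0"
  shows "\<not> local_comparability (gauss_measure d) (euclid_dist d) r"
proof
  interpret prob_space "gauss_measure d" by (rule prob_space_gauss_measure)
  assume "local_comparability (gauss_measure d) (euclid_dist d) r"
  then obtain C :: real where C: "C \<ge> 1" and comp: "\<And>x y. x \<in> space (lebesgue_PiM d) \<Longrightarrow>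
     y \<in> space (lebesgue_PiM d) \<Longrightarrow> euclid_dist d x y < r \<Longrightarrow>
     emeasure (gauss_measure d) (gball d x r) \<le> ennreal C * emeasure (gauss_measure d) (gball d y r)"
    unfolding local_comparability_def by (auto simp: space_gauss_measure space_PiM)
  define v :: "nat \<Rightarrow> real" where "v = (\<lambda>i. if i = 0 then 1 else 0)"
  have "L2_set v {..<d} = sqrt (\<Sum>i<d. if i = 0 then 1 else 0)"
    unfolding L2_set_def v_def by (intro arg_cong[where f=sqrt] sum.cong) auto
  then have v: "L2_set v {..<d} = 1" using d by simp
  define e where "e a = (\<lambda>i\<in>{..<d}. a * v i)" for a
  have e: "e a \<in> space (lebesgue_PiM d)" for a by (auto simp: e_def space_PiM)
  have dist: "euclid_dist d (e a) (e b) = \<bar>a - b\<bar>" for a b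
    by (simp add: e_def euclid_dist_scaled v)
  have norm: "L2_set (e a) {..<d} = \<bar>a\<bar>" for a by (simp add: e_def L2_set_scaled v)
  \<comment> \<open>The quotient of the densities is \<open>exp (r * R / 4 - 3 * r^2 / 32)\<close>.
    This \<open>R\<close> makes the exponent \<open>C * 4 ^ d + r^2\<close>, and
    \<open>exp t \<ge> 1 + t\<close> then contradicts the bound \<open>C * 4 ^ d\<close>.\<close>
  define R where "R = 3 * r / 8 + 4 * (C * 4 ^ d) / r + 4 * r"
  have R: "R \<ge> r"
  proof -
    have "0 \<le> 4 * (C * 4 ^ d) / r" using r C by simp
    then show ?thesis unfolding R_def using r by linarith
  qed
  let ?V = "ball_vol d"
  have "gdens d (R - r / 2) * ((r / 4) ^ d * ?V) \<le> measure (gauss_measure d) (gball d (e R) r)"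
  proof (rule gauss_measure_ball_ge[OF e e])
    show "gball d (e (R - 3 * r / 4)) (r / 4) \<subseteq> gball d (e R) r"
      by (rule gball_subset[OF e e]) (use r in \<open>simp add: dist\<close>)
    show "L2_set (e (R - 3 * r / 4)) {..<d} + r / 4 \<le> R - r / 2"
      using R r by (simp add: norm)
  qed (use r in auto)
  also have "\<dots> \<le> C * measure (gauss_measure d) (gball d (e (R + 3 * r / 4)) r)"
    using comp[OF e e, of R "R + 3 * r / 4"] r C
    by (simp add: dist emeasure_eq_measure ennreal_mult[symmetric])
  also have "\<dots> \<le> C * (gdens d (R - r / 4) * (r ^ d * ?V))"
  proof (rule mult_left_mono)
    have "emeasure (gauss_measure d) (gball d (e (R + 3 * r / 4)) r)
      \<le> ennreal (gdens d (R - r / 4)) * emeasure (lebesgue_PiM d) (gball d (e (R + 3 * r / 4)) r)"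
    proof (rule gauss_measure_le)
      fix z assume "z \<in> gball d (e (R + 3 * r / 4)) r"
      then have "euclid_dist d z (e (R + 3 * r / 4)) < r"
        by (simp add: gball_eq[OF e] euclid_dist_commute)
      then show "R - r / 4 \<le> L2_set z {..<d}"
        using L2_set_le_dist[of "e (R + 3 * r / 4)" d z] norm[of "R + 3 * r / 4"] by linarith
    qed (use R r in \<open>auto intro: gball_measurable[OF e]\<close>)
    then show "measure (gauss_measure d) (gball d (e (R + 3 * r / 4)) r) \<le> gdens d (R - r / 4) * (r ^ d * ?V)"
      using r ball_vol_pos[of d]
      by (simp add: emeasure_lebesgue_ball[OF e] emeasure_eq_measure ennreal_mult[symmetric])
  qed (use C in auto)
  finally have "exp (- (R - r / 2)\<^sup>2 / 2) * (r / 4) ^ d \<le> C * (exp (- (R - r / 4)\<^sup>2 / 2) * r ^ d)"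
    using ball_vol_pos[of d] by (simp add: mult_ac)
  then have "exp (- (R - r / 2)\<^sup>2 / 2) \<le> C * 4 ^ d * exp (- (R - r / 4)\<^sup>2 / 2)"
    using r by (simp add: power_divide field_simps)
  then have "exp (- (R - r / 2)\<^sup>2 / 2) / exp (- (R - r / 4)\<^sup>2 / 2) \<le> C * 4 ^ d"
    by (simp add: divide_le_eq)
  then have "exp (- (R - r / 2)\<^sup>2 / 2 - (- (R - r / 4)\<^sup>2 / 2)) \<le> C * 4 ^ d"
    by (simp only: exp_diff)
  moreover have "- (R - r / 2)\<^sup>2 / 2 - (- (R - r / 4)\<^sup>2 / 2) = C * 4 ^ d + r\<^sup>2"
    using r unfolding R_def by (simp add: field_simps power2_eq_square)
  ultimately show False
    using exp_ge_add_one_self[of "C * 4 ^ d + r\<^sup>2"] by (smt (verit) zero_le_power2)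
qed

section \<open>Strong type bounds\<close>

text \<open>Points with \<open>\<parallel>x\<parallel> < r/2\<close> contribute at most 1, because then \<open>B(0, r/2) \<subseteq> B(x, r)\<close>. For the other
  points, \<open>B(x, r)\<close> contains a ball of radius \<open>r/2\<close> on which the density is at least its value at
  \<open>x\<close>, so the density cancels and a quotient of Lebesgue volumes remains.\<close>

lemma averaging_kernel_bound:
  assumes y: "y \<in> space (lebesgue_PiM d)" and r: "r > 0"
  shows "(\<integral>\<^sup>+x. ennreal (indicator (gball d y r) x / measure (gauss_measure d) (gball d x r)) \<partial>gauss_measure d)
    \<le> ennreal (2 ^ d + 1)"
proof -
  interpret prob_space "gauss_measure d" by (rule prob_space_gauss_measure)
  define m where "m x = measure (gauss_measure d) (gball d x r)" for x
  define m0 where "m0 = measure (gauss_measure d) (gball d (origin d) (r / 2))"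
  have m0: "m0 > 0" unfolding m0_def using measure_gball_pos[OF origin_in_space, where r = "r / 2"] r by simp
  define W where "W = (r / 2) ^ d * ball_vol d"
  have W: "W > 0" using r ball_vol_pos[of d] by (simp add: W_def)
  have near: "m0 \<le> m x" if x: "x \<in> gball d (origin d) (r / 2)" for x
  proof -
    have xs: "x \<in> space (lebesgue_PiM d)" using x by (simp add: gball_eq[OF origin_in_space])
    have "gball d (origin d) (r / 2) \<subseteq> gball d x r"
      by (rule gball_subset[OF xs origin_in_space]) (use x in \<open>simp add: gball_eq[OF origin_in_space] euclid_dist_commute\<close>)
    then show ?thesis unfolding m_def m0_def
      by (intro finite_measure_mono) (auto intro: gball_measurable xs)
  qed
  have far: "gdens d (L2_set x {..<d}) * W \<le> m x"
    if x: "x \<in> space (lebesgue_PiM d)" and n: "L2_set x {..<d} \<ge> r / 2" for x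
  proof -
    \<comment> \<open>The point \<open>x\<close> moved by \<open>r / 2\<close> towards the origin;
      the ball of radius \<open>r / 2\<close> about it stays within the norm of
      \<open>x\<close>.\<close>
    define c where "c = (\<lambda>i\<in>{..<d}. (1 - r / (2 * L2_set x {..<d})) * x i)"
    have n0: "L2_set x {..<d} > 0" using n r by linarith
    have c: "c \<in> space (lebesgue_PiM d)" by (auto simp: c_def space_PiM)
    have "euclid_dist d x c = r / 2"
      using euclid_dist_scaled[of d 1 x "1 - r / (2 * L2_set x {..<d})"] n0 r
      unfolding restrict_id_PiM[OF x] c_def[symmetric] by simp
    then have sub: "gball d c (r / 2) \<subseteq> gball d x r"
      by (intro gball_subset[OF x c]) simp
    have "L2_set c {..<d} = (1 - r / (2 * L2_set x {..<d})) * L2_set x {..<d}"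
      unfolding c_def L2_set_scaled using n n0 r by (simp add: abs_of_nonneg field_simps)
    also have "\<dots> = L2_set x {..<d} - r / 2"
      using n0 by (simp add: field_simps)
    finally have "L2_set c {..<d} + r / 2 \<le> L2_set x {..<d}"
      by simp
    from gauss_measure_ball_ge[OF x c sub _ this] show ?thesis
      using r by (simp add: m_def W_def)
  qed
  \<comment> \<open>One bound valid in both cases. Its first term is free of the density and
    integrates over Lebesgue measure to the volume quotient \<open>2 ^ d\<close>; the second has
    Gaussian integral 1.\<close>
  have pw: "gdens d (L2_set x {..<d}) * (indicator (gball d y r) x / m x)
      \<le> indicator (gball d y r) x / W + gdens d (L2_set x {..<d}) * (indicator (gball d (origin d) (r / 2)) x / m0)"
    if x: "x \<in> space (lebesgue_PiM d)" for x
  proof (cases "L2_set x {..<d} \<ge> r / 2")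
    case True
    have m: "m x > 0" using measure_gball_pos[OF x r] by (simp add: m_def)
    have "gdens d (L2_set x {..<d}) * (indicator (gball d y r) x / m x) \<le> indicator (gball d y r) x / W"
      using far[OF x True] m W by (simp add: indicator_def field_simps)
    moreover have "0 \<le> gdens d (L2_set x {..<d}) * (indicator (gball d (origin d) (r / 2)) x / m0)"
      using m0 by simp
    ultimately show ?thesis by linarith
  next
    case False
    then have xo: "x \<in> gball d (origin d) (r / 2)" using x by (simp add: gball_eq[OF origin_in_space] euclid_dist_origin)
    have "indicator (gball d y r) x / m x \<le> 1 / m0"
      using near[OF xo] m0 by (intro frac_le) (auto simp: indicator_def)
    then have "gdens d (L2_set x {..<d}) * (indicator (gball d y r) x / m x)
      \<le> gdens d (L2_set x {..<d}) * (indicator (gball d (origin d) (r / 2)) x / m0)"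
      using xo by (intro mult_left_mono) auto
    moreover have "0 \<le> indicator (gball d y r) x / W" using W by simp
    ultimately show ?thesis by linarith
  qed
  have [measurable]: "m \<in> borel_measurable (lebesgue_PiM d)"
    unfolding m_def by measurable
  have [measurable]: "gball d y r \<in> sets (lebesgue_PiM d)" "gball d (origin d) (r / 2) \<in> sets (lebesgue_PiM d)"
    using y origin_in_space by (auto intro: gball_measurable)
  have "(\<integral>\<^sup>+x. ennreal (indicator (gball d y r) x / m x) \<partial>gauss_measure d)
    = (\<integral>\<^sup>+x. ennreal (gdens d (L2_set x {..<d}) * (indicator (gball d y r) x / m x)) \<partial>lebesgue_PiM d)"
    by (subst nn_integral_gauss) (simp, rule nn_integral_cong, rule ennreal_mult'[symmetric], simp)
  also have "\<dots> \<le> (\<integral>\<^sup>+x. ennreal (indicator (gball d y r) x / W)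
      + ennreal (gdens d (L2_set x {..<d}) * (indicator (gball d (origin d) (r / 2)) x / m0)) \<partial>lebesgue_PiM d)"
  proof (rule nn_integral_mono)
    fix x assume "x \<in> space (lebesgue_PiM d)"
    from ennreal_leI[OF pw[OF this]] W m0
    show "ennreal (gdens d (L2_set x {..<d}) * (indicator (gball d y r) x / m x))
       \<le> ennreal (indicator (gball d y r) x / W)
      + ennreal (gdens d (L2_set x {..<d}) * (indicator (gball d (origin d) (r / 2)) x / m0))"
      by (subst ennreal_plus[symmetric]) auto
  qed
  also have "\<dots> = (\<integral>\<^sup>+x. ennreal (indicator (gball d y r) x / W) \<partial>lebesgue_PiM d)
      + (\<integral>\<^sup>+x. ennreal (gdens d (L2_set x {..<d}) * (indicator (gball d (origin d) (r / 2)) x / m0)) \<partial>lebesgue_PiM d)"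
    by (intro nn_integral_add) auto
  also have "(\<integral>\<^sup>+x. ennreal (indicator (gball d y r) x / W) \<partial>lebesgue_PiM d) = ennreal (2 ^ d)"
  proof -
    have "(\<integral>\<^sup>+x. ennreal (indicator (gball d y r) x / W) \<partial>lebesgue_PiM d)
      = (\<integral>\<^sup>+x. ennreal (1 / W) * indicator (gball d y r) x \<partial>lebesgue_PiM d)"
      by (intro nn_integral_cong) (auto simp: indicator_def)
    also have "\<dots> = ennreal (1 / W) * ennreal (r ^ d * ball_vol d)"
      by (simp add: nn_integral_cmult_indicator emeasure_lebesgue_ball[OF y r])
    also have "\<dots> = ennreal (1 / W * (r ^ d * ball_vol d))"
      using W r ball_vol_pos[of d] by (intro ennreal_mult[symmetric]) auto
    also have "1 / W * (r ^ d * ball_vol d) = 2 ^ d"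
      using r ball_vol_pos[of d] by (simp add: W_def power_divide)
    finally show ?thesis .
  qed
  also have "(\<integral>\<^sup>+x. ennreal (gdens d (L2_set x {..<d}) * (indicator (gball d (origin d) (r / 2)) x / m0)) \<partial>lebesgue_PiM d)
    = (\<integral>\<^sup>+x. ennreal (1 / m0) * indicator (gball d (origin d) (r / 2)) x \<partial>gauss_measure d)"
    by (subst nn_integral_gauss)
       (simp, intro nn_integral_cong, subst ennreal_mult', simp,
        rule arg_cong2[where f="(*)"], simp_all add: indicator_def)
  also have "\<dots> = ennreal (1 / m0) * ennreal m0"
    by (simp add: nn_integral_cmult_indicator m0_def emeasure_eq_measure)
  also have "\<dots> = ennreal 1"
    using m0 by (subst ennreal_mult[symmetric]) auto
  also have "ennreal (2 ^ d) + ennreal 1 = ennreal (2 ^ d + 1)"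
    by (subst ennreal_plus) auto
  finally show ?thesis by (simp add: m_def)
qed

section \<open>Jensen's inequality and the operator bound\<close>

text \<open>The convex function \<open>t powr p\<close> lies above its tangent at \<open>c\<close>.
  For \<open>t > 0\<close> this is Young's inequality for \<open>(t / c) powr p\<close> and 1 with
  weights \<open>1 / p\<close> and \<open>1 - 1 / p\<close>.\<close>

lemma powr_tangent_le:
  fixes c t p :: real
  assumes c: "c > 0" and t: "t \<ge> 0" and p: "p \<ge> 1"
  shows "c powr p + p * c powr (p - 1) * (t - c) \<le> t powr p"
proof (cases "t = 0")
  case True
  have "c powr (p - 1) * c = c powr p"
    using c by (simp add: powr_mult_base mult.commute)
  then have "c powr p + p * c powr (p - 1) * (t - c) = (1 - p) * c powr p"
    using True by (simp add: algebra_simps)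
  also have "\<dots> \<le> 0" using p by (simp add: mult_nonpos_nonneg)
  finally show ?thesis using True by simp
next
  case False
  with t have t: "t > 0" by simp
  have "((t / c) powr p) powr (1 / p) * 1 powr (1 - 1 / p) \<le> 1 / p * (t / c) powr p + (1 - 1 / p) * 1"
    using c t p by (intro Youngs_inequality_0) auto
  then have "t / c \<le> 1 / p * (t / c) powr p + (1 - 1 / p)"
    using c t p by (simp add: powr_powr)
  then have "p * (t / c) \<le> p * (1 / p * (t / c) powr p + (1 - 1 / p))"
    using p by (intro mult_left_mono) auto
  also have "\<dots> = (t / c) powr p + p - 1"
    using p by (simp add: right_diff_distrib distrib_left)
  finally have "1 + p * (t / c - 1) \<le> (t / c) powr p"
    by (simp add: right_diff_distrib)
  then have "c powr p * (1 + p * (t / c - 1)) \<le> c powr p * (t / c) powr p"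
    by (intro mult_left_mono) auto
  also have "c powr p * (t / c) powr p = t powr p"
    using c t by (simp add: powr_divide)
  also have "c powr p * (1 + p * (t / c - 1)) = c powr p + p * c powr (p - 1) * (t - c)"
    using c by (simp add: powr_diff field_simps)
  finally show ?thesis .
qed

text \<open>Jensen's inequality for the Gaussian measure normalised on the ball. The tangent
  inequality at the modulus \<open>c\<close> of the average is integrated over the ball; the linear
  term contributes a nonnegative amount because \<open>c * m\<close> is at most the integral of the
  modulus of \<open>g\<close>.\<close>

lemma averaging_powr_le:
  assumes x: "x \<in> space (lebesgue_PiM d)" and r: "r > 0" and p: "p \<ge> 1"
    and g: "g \<in> Lp_space p (gauss_measure d)"
  shows "ennreal (\<bar>gauss_avg d r g x\<bar> powr p) \<le> (\<integral>\<^sup>+y. ennreal (indicator (gball d x r) y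
    / measure (gauss_measure d) (gball d x r) * \<bar>g y\<bar> powr p) \<partial>gauss_measure d)"
proof -
  interpret prob_space "gauss_measure d" by (rule prob_space_gauss_measure)
  let ?B = "gball d x r"
  define m where "m = measure (gauss_measure d) ?B"
  have m: "m > 0" unfolding m_def by (rule measure_gball_pos[OF x r])
  have B [measurable]: "?B \<in> sets (gauss_measure d)" by (simp add: gball_measurable x)
  have [measurable]: "g \<in> borel_measurable (gauss_measure d)"
    and gp: "integrable (gauss_measure d) (\<lambda>x. \<bar>g x\<bar> powr p)"
    using g by (auto simp: Lp_space_def)
  \<comment> \<open>On a probability space this puts \<open>L^p\<close> inside \<open>L^1\<close>,
    so the average is a genuine integral and not the default value 0.\<close>
  have le: "\<bar>g y\<bar> \<le> 1 + \<bar>g y\<bar> powr p" for y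
  proof (cases "\<bar>g y\<bar> \<le> 1")
    case False
    then have "\<bar>g y\<bar> powr 1 \<le> \<bar>g y\<bar> powr p" using p by (intro powr_mono) auto
    then show ?thesis using False by simp
  qed (simp add: add_increasing2)
  have g1: "integrable (gauss_measure d) g"
    by (rule Bochner_Integration.integrable_bound[where f="\<lambda>y. 1 + \<bar>g y\<bar> powr p"])
       (use gp le in \<open>auto intro!: Bochner_Integration.integrable_add AE_I2 order_trans[OF le]\<close>)
  define c where "c = \<bar>gauss_avg d r g x\<bar>"
  have ind: "integrable (gauss_measure d) (\<lambda>y. indicator ?B y * f y)"
    if "integrable (gauss_measure d) f" for f :: "_ \<Rightarrow> real"
    using integrable_mult_indicator[OF _ that, of ?B] by (simp add: gball_measurable x)
  have B1: "integrable (gauss_measure d) (\<lambda>y. indicator ?B y :: real)" "(LINT y|gauss_measure d. indicator ?B y) = m"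
    using ind[of "\<lambda>_. 1"] by (simp_all add: m_def sets.Int_space_eq2[OF B])
  have cm: "c * m \<le> (LINT y|gauss_measure d. indicator ?B y * \<bar>g y\<bar>)"
  proof -
    have "c * m = \<bar>LINT y|gauss_measure d. indicator ?B y * g y\<bar>"
      using m unfolding c_def averaging_def m_def[symmetric] set_lebesgue_integral_def
      by (simp add: abs_mult)
    also have "\<dots> \<le> (LINT y|gauss_measure d. \<bar>indicator ?B y * g y\<bar>)"
      by (rule integral_abs_bound)
    finally show ?thesis by (simp add: abs_mult)
  qed
  have "c powr p * m \<le> (LINT y|gauss_measure d. indicator ?B y * \<bar>g y\<bar> powr p)"
  proof (cases "c = 0")
    case True
    then show ?thesis using p by (simp add: integral_nonneg_AE)
  next
    case False
    then have c: "c > 0" by (simp add: c_def)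
    let ?k = "p * c powr (p - 1)"
    have "c powr p * m \<le> c powr p * m + ?k * ((LINT y|gauss_measure d. indicator ?B y * \<bar>g y\<bar>) - c * m)"
      using cm p by simp
    also have "\<dots> = (c powr p - ?k * c) * m + ?k * (LINT y|gauss_measure d. indicator ?B y * \<bar>g y\<bar>)"
      by (simp add: algebra_simps)
    also have "\<dots> = (LINT y|gauss_measure d. (c powr p - ?k * c) * indicator ?B y + ?k * (indicator ?B y * \<bar>g y\<bar>))"
      using B1 ind[OF integrable_abs[OF g1]] by (subst Bochner_Integration.integral_add) auto
    also have "\<dots> \<le> (LINT y|gauss_measure d. indicator ?B y * \<bar>g y\<bar> powr p)"
    proof (rule integral_mono)
      show "integrable (gauss_measure d) (\<lambda>y. (c powr p - ?k * c) * indicator ?B y + ?k * (indicator ?B y * \<bar>g y\<bar>))"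
        using B1 ind[OF integrable_abs[OF g1]] by (intro Bochner_Integration.integrable_add integrable_mult_right) auto
      fix y
      show "(c powr p - ?k * c) * indicator ?B y + ?k * (indicator ?B y * \<bar>g y\<bar>) \<le> indicator ?B y * \<bar>g y\<bar> powr p"
        using powr_tangent_le[OF c _ p, of "\<bar>g y\<bar>"] by (auto simp: indicator_def algebra_simps)
    qed (rule ind[OF gp])
    finally show ?thesis .
  qed
  then have "c powr p \<le> (LINT y|gauss_measure d. indicator ?B y * \<bar>g y\<bar> powr p) / m"
    using m by (simp add: pos_le_divide_eq)
  also have "\<dots> = (LINT y|gauss_measure d. indicator ?B y / m * \<bar>g y\<bar> powr p)"
    unfolding integral_divide_zero[symmetric] by (intro Bochner_Integration.integral_cong) auto
  finally have "c powr p \<le> \<dots>" .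
  moreover have "integrable (gauss_measure d) (\<lambda>y. indicator ?B y / m * \<bar>g y\<bar> powr p)"
    using integrable_divide[OF ind[OF gp], of m] by simp
  ultimately show ?thesis
    using m unfolding c_def m_def[symmetric]
    by (subst nn_integral_eq_integral) (auto intro!: ennreal_leI)
qed

text \<open>With the ball indicator written as a jointly measurable function of centre and point,
  the average is a parameter integral divided by a measurable function.\<close>

lemma averaging_measurable:
  assumes g: "g \<in> borel_measurable (gauss_measure d)"
  shows "gauss_avg d r g \<in> borel_measurable (gauss_measure d)"
proof -
  interpret prob_space "gauss_measure d" by (rule prob_space_gauss_measure)
  have [measurable]: "g \<in> borel_measurable (lebesgue_PiM d)"
    using g by (simp cong: measurable_cong_sets)
  have "(\<lambda>xy. euclid_dist d (fst xy) (snd xy)) \<in> borel_measurable (lebesgue_PiM d \<Otimes>\<^sub>M lebesgue_PiM d)"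
    by (rule measurable_euclid_dist[OF measurable_fst measurable_snd])
  note dm [measurable] = this
  have "(\<lambda>xy. (if euclid_dist d (fst xy) (snd xy) < r then 1 else 0) * g (snd xy))
     \<in> borel_measurable (lebesgue_PiM d \<Otimes>\<^sub>M lebesgue_PiM d)"
    by (intro borel_measurable_times measurable_If measurable_const borel_measurable_less
         measurable_compose[OF measurable_snd]) (auto intro: dm)
  then have m: "(\<lambda>(x, y). (if euclid_dist d x y < r then 1 else 0) * g y)
     \<in> borel_measurable (lebesgue_PiM d \<Otimes>\<^sub>M gauss_measure d)"
    by (simp add: case_prod_beta cong: measurable_cong_sets sets_pair_measure_cong)
  have "(\<lambda>x. 1 / measure (gauss_measure d) (gball d x r) *
      (LINT y|gauss_measure d. (if euclid_dist d x y < r then 1 else 0) * g y)) \<in> borel_measurable (lebesgue_PiM d)"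
    using borel_measurable_lebesgue_integral[OF m]
    by (intro borel_measurable_times borel_measurable_divide measurable_measure_gball) auto
  also have "?this \<longleftrightarrow> gauss_avg d r g \<in> borel_measurable (lebesgue_PiM d)"
  proof (rule measurable_cong)
    fix x assume x: "x \<in> space (lebesgue_PiM d)"
    show "1 / measure (gauss_measure d) (gball d x r) *
      (LINT y|gauss_measure d. (if euclid_dist d x y < r then 1 else 0) * g y) = gauss_avg d r g x"
      unfolding averaging_def set_lebesgue_integral_def
      by (intro arg_cong2[where f="(*)"] refl Bochner_Integration.integral_cong)
         (unfold gball_eq[OF x], simp_all add: indicator_def space_gauss_measure space_PiM)
  qed
  finally show ?thesis by (simp cong: measurable_cong_sets)
qed

text \<open>A Schur test: Jensen's inequality uses that the kernel has integral 1 in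
  \<open>y\<close>, and the kernel bound controls its integral in \<open>x\<close> after the
  exchange of integrals.\<close>

lemma strong_norm_gauss_avg_le:
  assumes r: "r > 0" and p: "p \<ge> 1"
  shows "strong_norm p (gauss_measure d) (gauss_avg d r) \<le> ennreal ((2 ^ d + 1) powr (1 / p))"
proof -
  interpret prob_space "gauss_measure d" by (rule prob_space_gauss_measure)
  interpret P: pair_sigma_finite "gauss_measure d" "gauss_measure d" ..
  define m where "m x = measure (gauss_measure d) (gball d x r)" for x
  have "gauss_avg d r g \<in> Lp_space p (gauss_measure d) \<and>
     Lp_norm p (gauss_measure d) (gauss_avg d r g) \<le> (2 ^ d + 1) powr (1 / p) * Lp_norm p (gauss_measure d) g"
    if g: "g \<in> Lp_space p (gauss_measure d)" for g
  proof -
    have gm [measurable]: "g \<in> borel_measurable (gauss_measure d)"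
      and gp: "integrable (gauss_measure d) (\<lambda>x. \<bar>g x\<bar> powr p)"
      using g by (auto simp: Lp_space_def)
    have Am [measurable]: "gauss_avg d r g \<in> borel_measurable (gauss_measure d)"
      by (rule averaging_measurable[OF gm])
    let ?I = "\<lambda>x y. (if euclid_dist d x y < r then 1 else 0) / m x"
    \<comment> \<open>Since the distance is symmetric, the same kernel carries the indicator of the
      ball about \<open>x\<close> or about \<open>y\<close>; the first form fits Jensen's
      inequality, the second the kernel bound.\<close>
    have ind: "indicator (gball d x r) y / m x = ?I x y"
      "indicator (gball d y r) x / m x = ?I x y"
      if "x \<in> space (gauss_measure d)" "y \<in> space (gauss_measure d)" for x y
      using that gball_eq[of x d r] gball_eq[of y d r]
      by (simp_all add: indicator_def space_gauss_measure space_PiM euclid_dist_commute[of d y x])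
    have dm: "(\<lambda>xy. euclid_dist d (fst xy) (snd xy)) \<in> borel_measurable (lebesgue_PiM d \<Otimes>\<^sub>M lebesgue_PiM d)"
      by (rule measurable_euclid_dist[OF measurable_fst measurable_snd])
    have mm: "m \<in> borel_measurable (lebesgue_PiM d)"
      unfolding m_def by (rule measurable_measure_gball)
    have gm': "(\<lambda>y. \<bar>g y\<bar> powr p) \<in> borel_measurable (lebesgue_PiM d)"
      using borel_measurable_integrable[OF gp] by (simp cong: measurable_cong_sets)
    have "(\<lambda>xy. ennreal (?I (fst xy) (snd xy) * \<bar>g (snd xy)\<bar> powr p))
      \<in> borel_measurable (lebesgue_PiM d \<Otimes>\<^sub>M lebesgue_PiM d)"
      by (intro measurable_compose[OF _ measurable_ennreal] borel_measurable_times borel_measurable_divide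
            measurable_If measurable_const borel_measurable_less
            measurable_compose[OF measurable_snd gm'] measurable_compose[OF measurable_fst mm])
         (auto intro: dm)
    then have fub: "(\<lambda>(x, y). ennreal (?I x y * \<bar>g y\<bar> powr p)) \<in> borel_measurable (gauss_measure d \<Otimes>\<^sub>M gauss_measure d)"
      by (simp add: case_prod_beta cong: measurable_cong_sets sets_pair_measure_cong)
    have "(\<integral>\<^sup>+x. ennreal (\<bar>gauss_avg d r g x\<bar> powr p) \<partial>gauss_measure d)
      \<le> (\<integral>\<^sup>+x. \<integral>\<^sup>+y. ennreal (?I x y * \<bar>g y\<bar> powr p) \<partial>gauss_measure d \<partial>gauss_measure d)"
    proof (rule nn_integral_mono)
      fix x assume x: "x \<in> space (gauss_measure d)"
      then have "ennreal (\<bar>gauss_avg d r g x\<bar> powr p) \<le> (\<integral>\<^sup>+y. ennreal (indicator (gball d x r) y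
          / m x * \<bar>g y\<bar> powr p) \<partial>gauss_measure d)"
        unfolding m_def by (intro averaging_powr_le r p g) (simp add: space_gauss_measure space_PiM)
      also have "\<dots> = (\<integral>\<^sup>+y. ennreal (?I x y * \<bar>g y\<bar> powr p) \<partial>gauss_measure d)"
        by (intro nn_integral_cong arg_cong[where f=ennreal] arg_cong2[where f="(*)"] ind(1) x refl)
      finally show "ennreal (\<bar>gauss_avg d r g x\<bar> powr p) \<le> \<dots>" .
    qed
    also have "\<dots> = (\<integral>\<^sup>+y. \<integral>\<^sup>+x. ennreal (?I x y * \<bar>g y\<bar> powr p) \<partial>gauss_measure d \<partial>gauss_measure d)"
      by (rule P.Fubini'[OF fub, symmetric])
    also have "\<dots> \<le> (\<integral>\<^sup>+y. ennreal (2 ^ d + 1) * ennreal (\<bar>g y\<bar> powr p) \<partial>gauss_measure d)"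
    proof (rule nn_integral_mono)
      fix y assume y: "y \<in> space (gauss_measure d)"
      have Im: "(\<lambda>x. ?I x y) \<in> borel_measurable (gauss_measure d)"
      proof -
        have "(\<lambda>x. euclid_dist d x y) \<in> borel_measurable (lebesgue_PiM d)"
          using y by (intro measurable_euclid_dist) (auto simp: space_gauss_measure space_PiM)
        then have "(\<lambda>x. ?I x y) \<in> borel_measurable (lebesgue_PiM d)"
          by (intro borel_measurable_divide mm measurable_If measurable_const borel_measurable_less) auto
        then show ?thesis by (simp cong: measurable_cong_sets)
      qed
      have "(\<integral>\<^sup>+x. ennreal (?I x y * \<bar>g y\<bar> powr p) \<partial>gauss_measure d)
        = (\<integral>\<^sup>+x. ennreal (?I x y) \<partial>gauss_measure d) * ennreal (\<bar>g y\<bar> powr p)"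
        using Im by (subst nn_integral_multc[symmetric])
          (simp, rule nn_integral_cong, rule ennreal_mult'', simp)
      also have "(\<integral>\<^sup>+x. ennreal (?I x y) \<partial>gauss_measure d)
         = (\<integral>\<^sup>+x. ennreal (indicator (gball d y r) x / m x) \<partial>gauss_measure d)"
        by (intro nn_integral_cong arg_cong[where f=ennreal] ind(2)[symmetric] y)
      also have "\<dots> \<le> ennreal (2 ^ d + 1)"
        unfolding m_def using y by (intro averaging_kernel_bound r) (simp add: space_gauss_measure space_PiM)
      finally show "(\<integral>\<^sup>+x. ennreal (?I x y * \<bar>g y\<bar> powr p) \<partial>gauss_measure d) \<le> ennreal (2 ^ d + 1) * ennreal (\<bar>g y\<bar> powr p)"
        by (simp add: mult_right_mono)
    qed
    also have "\<dots> = ennreal (2 ^ d + 1) * ennreal (LINT y|gauss_measure d. \<bar>g y\<bar> powr p)"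
      using gp by (subst nn_integral_cmult) (auto simp: nn_integral_eq_integral)
    also have "\<dots> = ennreal ((2 ^ d + 1) * (LINT y|gauss_measure d. \<bar>g y\<bar> powr p))"
      by (intro ennreal_mult[symmetric]) (auto intro: integral_nonneg_AE)
    finally have le: "(\<integral>\<^sup>+x. ennreal (\<bar>gauss_avg d r g x\<bar> powr p) \<partial>gauss_measure d) \<le> \<dots>" .
    \<comment> \<open>Finiteness of the bound also gives membership in \<open>L^p\<close>, which
      \<open>strong_norm\<close> demands.\<close>
    have int: "integrable (gauss_measure d) (\<lambda>x. \<bar>gauss_avg d r g x\<bar> powr p)"
      using le_less_trans[OF le ennreal_less_top] by (intro integrableI_nonneg) auto
    have "(LINT x|gauss_measure d. \<bar>gauss_avg d r g x\<bar> powr p) \<le> (2 ^ d + 1) * (LINT y|gauss_measure d. \<bar>g y\<bar> powr p)"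
      using le int by (subst (asm) nn_integral_eq_integral) (auto simp: ennreal_le_iff integral_nonneg_AE)
    then have "Lp_norm p (gauss_measure d) (gauss_avg d r g)
      \<le> ((2 ^ d + 1) * (LINT y|gauss_measure d. \<bar>g y\<bar> powr p)) powr (1 / p)"
      unfolding Lp_norm_def using p by (intro powr_mono2) (auto intro: integral_nonneg_AE)
    also have "\<dots> = (2 ^ d + 1) powr (1 / p) * Lp_norm p (gauss_measure d) g"
      unfolding Lp_norm_def by (rule powr_mult)
    finally show ?thesis
      using int Am by (simp add: Lp_space_def)
  qed
  then show ?thesis
    unfolding strong_norm_def by (intro Inf_lower) (auto intro!: exI[of _ "(2 ^ d + 1) powr (1 / p)"])
qed

section \<open>Comparison of the dimensional constants\<close>

text \<open>The summands are compared separately: \<open>sqrt (2 * pi * real d) \<ge> 2\<close>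
  accounts for \<open>2 ^ d\<close>, and the second summand is at least 1.\<close>

lemma dimension_constant_le:
  assumes "d \<ge> 1"
  shows "2 ^ d + 1 \<le> 2 ^ (d - 1) * sqrt (2 * pi * real d) + sqrt (pi * (real d + 1)) * (2 / sqrt 3) ^ (d + 1)"
proof -
  have "2 = sqrt (2 * 2 * 1)" by (simp add: real_sqrt_mult)
  also have "\<dots> \<le> sqrt (2 * pi * real d)"
    using assms pi_gt3 by (intro real_sqrt_le_mono mult_mono) auto
  finally have "2 ^ (d - 1) * 2 \<le> 2 ^ (d - 1) * sqrt (2 * pi * real d)"
    by (intro mult_left_mono) auto
  moreover have "(2::real) ^ (d - 1) * 2 = 2 ^ d"
    using assms by (cases d) auto
  moreover have "1 * 1 \<le> sqrt (pi * (real d + 1)) * (2 / sqrt 3) ^ (d + 1)"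
  proof (rule mult_mono)
    have "1 * 1 \<le> pi * (real d + 1)" using pi_gt3 by (intro mult_mono) auto
    then show "1 \<le> sqrt (pi * (real d + 1))" by simp
    have "sqrt 3 \<le> sqrt 4" by (intro real_sqrt_le_mono) auto
    then have "1 \<le> 2 / sqrt 3" by simp
    then show "1 \<le> (2 / sqrt 3) ^ (d + 1)" by (rule one_le_power)
  qed auto
  ultimately show ?thesis by linarith
qed

text \<open>Bernoulli's inequality gives \<open>(1 + \<epsilon> / 2) ^ d \<ge> 2\<close>, and
  doubling \<open>2 ^ d\<close> absorbs the summand 1.\<close>

lemma two_power_add_one_le:
  fixes \<epsilon> :: real
  assumes e: "\<epsilon> > 0" and d: "2 / \<epsilon> \<le> real d"
  shows "2 ^ d + 1 \<le> (2 + \<epsilon>) ^ d"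
proof -
  have "1 \<le> real d * (\<epsilon> / 2)" using e d by (simp add: field_simps)
  then have "2 \<le> 1 + real d * (\<epsilon> / 2)" by simp
  also have "\<dots> \<le> (1 + \<epsilon> / 2) ^ d" using e by (intro Bernoulli_inequality) auto
  finally have "2 ^ d * 2 \<le> 2 ^ d * (1 + \<epsilon> / 2) ^ d" by simp
  also have "\<dots> = (2 + \<epsilon>) ^ d" by (simp add: power_mult_distrib[symmetric] algebra_simps)
  finally show ?thesis using one_le_power[of "2::real" d] by linarith
qed

lemma SUP_strong_norm_le:
  assumes "d \<ge> 1" "p \<ge> 1"
  shows "(SUP r\<in>{0<..}. strong_norm p (gauss_measure d) (gauss_avg d r))
          \<le> ennreal ((2 ^ (d - 1) * sqrt (2 * pi * real d)
              + sqrt (pi * (real d + 1)) * (2 / sqrt 3) ^ (d + 1)) powr (1 / p))"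
proof (rule SUP_least)
  fix r :: real assume "r \<in> {0<..}"
  then have "strong_norm p (gauss_measure d) (gauss_avg d r) \<le> ennreal ((2 ^ d + 1) powr (1 / p))"
    using assms by (intro strong_norm_gauss_avg_le) auto
  also have "\<dots> \<le> ennreal ((2 ^ (d - 1) * sqrt (2 * pi * real d)
              + sqrt (pi * (real d + 1)) * (2 / sqrt 3) ^ (d + 1)) powr (1 / p))"
    using assms by (intro ennreal_leI powr_mono2 dimension_constant_le) auto
  finally show "strong_norm p (gauss_measure d) (gauss_avg d r) \<le> \<dots>" .
qed

lemma SUP_strong_norm_le_eventually:
  assumes e: "(\<epsilon>::real) > 0"
  shows "\<exists>D\<ge>1. \<forall>d\<ge>D. \<forall>p\<ge>1. (SUP r\<in>{0<..}. strong_norm p (gauss_measure d) (gauss_avg d r))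
          \<le> ennreal ((2 + \<epsilon>) powr (real d / p))"
proof (intro exI conjI allI impI SUP_least)
  \<comment> \<open>The threshold depends on \<open>\<epsilon>\<close> alone, so it serves all
    \<open>p\<close> and \<open>r\<close>; \<open>Suc\<close> makes it at least 1.\<close>
  let ?D = "Suc (nat \<lceil>2 / \<epsilon>\<rceil>)"
  fix d :: nat and p r :: real assume d: "?D \<le> d" and p: "1 \<le> p" and r: "r \<in> {0<..}"
  have "2 / \<epsilon> \<le> real (nat \<lceil>2 / \<epsilon>\<rceil>)" by (rule real_nat_ceiling_ge)
  also have "\<dots> \<le> real d" using d by (intro of_nat_mono) linarith
  finally have d': "2 / \<epsilon> \<le> real d" .
  have "strong_norm p (gauss_measure d) (gauss_avg d r) \<le> ennreal ((2 ^ d + 1) powr (1 / p))"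
    using p r by (intro strong_norm_gauss_avg_le) auto
  also have "\<dots> \<le> ennreal (((2 + \<epsilon>) ^ d) powr (1 / p))"
    using p by (intro ennreal_leI powr_mono2 two_power_add_one_le e d') auto
  also have "((2 + \<epsilon>) ^ d) powr (1 / p) = (2 + \<epsilon>) powr (real d / p)"
    using e by (simp add: powr_realpow[symmetric] powr_powr)
  finally show "strong_norm p (gauss_measure d) (gauss_avg d r) \<le> ennreal ((2 + \<epsilon>) powr (real d / p))" .
qed simp

section \<open>Weak type lower bound\<close>

text \<open>The case \<open>l = 0\<close> of the moment formula, normalised by the dimension:
  \<open>T\<close> and \<open>R\<close> are squared norms per coordinate, and the result is a rate
  multiplied by \<open>real d / 2\<close>.\<close>

lemma gauss_chernoff_dist:
  assumes k: "1 + k > 0" and T: "(L2_set x {..<d})\<^sup>2 = T * real d"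
  shows "(\<integral>\<^sup>+z. ennreal (exp (k * (R * real d - (euclid_dist d x z)\<^sup>2) / 2)) \<partial>gauss_measure d)
    = ennreal (exp (real d / 2 * (k * R - ln (1 + k) - T * k / (1 + k))))"
proof -
  have "(\<integral>\<^sup>+z. ennreal (exp (k * (R * real d - (euclid_dist d x z)\<^sup>2) / 2)) \<partial>gauss_measure d)
    = (\<integral>\<^sup>+z. ennreal (exp (k * R * real d / 2)) *
        ennreal (exp ((0 * (L2_set z {..<d})\<^sup>2 - k * (euclid_dist d x z)\<^sup>2) / 2)) \<partial>gauss_measure d)"
    by (intro nn_integral_cong)
       (simp add: ennreal_mult[symmetric] exp_add[symmetric] diff_divide_distrib right_diff_distrib)
  also have "\<dots> = ennreal (exp (k * R * real d / 2)) *
     (\<integral>\<^sup>+z. ennreal (exp ((0 * (L2_set z {..<d})\<^sup>2 - k * (euclid_dist d x z)\<^sup>2) / 2)) \<partial>gauss_measure d)"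
    by (rule nn_integral_cmult) simp
  also have "\<dots> = ennreal (exp (k * R * real d / 2) *
     ((1 + k) powr (- real d / 2) * exp ((k\<^sup>2 / (1 + k) - k) / 2 * (T * real d))))"
    using gauss_chernoff[of 0 k d x] k by (simp add: T ennreal_mult)
  also have "exp (k * R * real d / 2) * ((1 + k) powr (- real d / 2) * exp ((k\<^sup>2 / (1 + k) - k) / 2 * (T * real d)))
    = exp (real d / 2 * (k * R - ln (1 + k) - T * k / (1 + k)))"
  proof -
    have "k\<^sup>2 / (1 + k) - k = - k / (1 + k)"
      using k by (simp add: field_simps power2_eq_square)
    then have eq: "(k\<^sup>2 / (1 + k) - k) / 2 * (T * real d) = - (real d / 2 * (T * k / (1 + k)))"
      by (simp only: divide_inverse) (simp only: mult_minus_left mult_minus_right mult_ac)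
    define q where "q = T * k / (1 + k)"
    show ?thesis
      unfolding eq q_def[symmetric] using k
      by (simp add: powr_def exp_add[symmetric] right_diff_distrib)
  qed
  finally show ?thesis .
qed

lemma inverse_one_minus_le:
  fixes y :: real
  assumes "0 \<le> y" "y \<le> 1 / 2"
  shows "1 / (1 - y) \<le> 1 + 2 * y"
proof -
  have "0 \<le> y * (1 - 2 * y)" using assms by simp
  then show ?thesis using assms by (simp add: divide_le_eq algebra_simps)
qed

text \<open>These are the second-order errors, in \<open>\<sigma> * u\<close>, of the two expansions
  below.\<close>

lemma tilt_square_bounds:
  fixes u T \<sigma> :: real
  assumes u: "0 < u" "u \<le> 1" and T: "0 \<le> T" "T \<le> 1" and \<sigma>: "0 \<le> \<sigma>"
  shows "(\<sigma> * u)\<^sup>2 \<le> \<sigma>\<^sup>2" "T * (\<sigma> * u\<^sup>2 * (\<sigma> * u)) \<le> \<sigma>\<^sup>2"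
proof -
  show "(\<sigma> * u)\<^sup>2 \<le> \<sigma>\<^sup>2" using u \<sigma> by (auto intro!: power_mono mult_left_le)
  have "T * u ^ 3 \<le> 1 * 1" using T u by (intro mult_mono power_le_one) auto
  then have "\<sigma>\<^sup>2 * (T * u ^ 3) \<le> \<sigma>\<^sup>2 * 1" by (intro mult_left_mono) auto
  then show "T * (\<sigma> * u\<^sup>2 * (\<sigma> * u)) \<le> \<sigma>\<^sup>2"
    by (simp add: power2_eq_square power3_eq_cube mult_ac)
qed

text \<open>In the next two lemmas \<open>1 / u = 1 + k\<close>, where \<open>k\<close> is the tilting parameter, \<open>T\<close> and \<open>R\<close>
  stand for \<open>\<parallel>x\<parallel>\<^sup>2 / d\<close> and \<open>r\<^sup>2 / d\<close>, and \<open>u + T u\<^sup>2\<close> is the mean of \<open>\<parallel>z - x\<parallel>\<^sup>2 / d\<close> under the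
  tilted Gaussian; changing \<open>k\<close> by \<open>\<sigma>\<close> away from that mean gains a quadratic term.\<close>

lemma tilt_decrease_exponent:
  fixes u T R \<zeta> \<sigma> :: real
  assumes u: "0 < u" "u \<le> 1" and T: "0 \<le> T" "T \<le> 1" and z: "0 < \<zeta>" "\<zeta> \<le> 1"
    and R: "u + T * u\<^sup>2 + \<zeta> \<le> R" and \<sigma>: "\<sigma> = \<zeta> / 8"
  shows "(1 / u - 1 - \<sigma>) * R - ln (1 / u - \<sigma>) - T * (1 / u - 1 - \<sigma>) / (1 / u - \<sigma>)
    \<le> (1 / u - 1) * R + ln u - (1 - u) * T - \<zeta>\<^sup>2 / 16"
proof -
  define y where "y = \<sigma> * u"
  have y: "0 \<le> y" "y \<le> 1 / 8"
    using u z mult_mono[of \<sigma> "1/8" u 1] by (auto simp: y_def \<sigma>)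
  have y2: "y\<^sup>2 \<le> \<sigma>\<^sup>2" "T * (\<sigma> * u\<^sup>2 * y) \<le> \<sigma>\<^sup>2"
    using tilt_square_bounds[of u T \<sigma>] u T z by (simp_all add: y_def \<sigma>)
  have e1: "1 / u - \<sigma> = (1 - y) / u" using u by (simp add: y_def field_simps)
  have ln: "ln (1 / u - \<sigma>) = ln (1 - y) - ln u"
    unfolding e1 using u y by (simp add: ln_div)
  have "- y - 2 * y\<^sup>2 \<le> ln (1 - y)"
    using y by (intro ln_one_minus_pos_lower_bound) auto
  moreover have "T * (1 / u - 1 - \<sigma>) / (1 / u - \<sigma>) = T - T * u * (1 / (1 - y))"
  proof -
    have "T * (1 / u - 1 - \<sigma>) = T * (1 / u - \<sigma>) - T" by (simp add: algebra_simps)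
    moreover have "1 / u - \<sigma> \<noteq> 0" unfolding e1 using u y by simp
    ultimately have "T * (1 / u - 1 - \<sigma>) / (1 / u - \<sigma>) = T - T / (1 / u - \<sigma>)"
      by (simp add: diff_divide_distrib)
    then show ?thesis unfolding e1 by simp
  qed
  moreover have "T * u * (1 / (1 - y)) \<le> T * u * (1 + y * (1 + 2 * y))"
  proof (intro mult_left_mono)
    have "1 / (1 - y) = 1 + y * (1 / (1 - y))" using y by (simp add: field_simps)
    also have "\<dots> \<le> 1 + y * (1 + 2 * y)"
      using inverse_one_minus_le[of y] y by (intro add_left_mono mult_left_mono) auto
    finally show "1 / (1 - y) \<le> 1 + y * (1 + 2 * y)" .
  qed (use T u in auto)
  moreover have "T * u * (1 + y * (1 + 2 * y)) = T * u + \<sigma> * (T * u\<^sup>2) + 2 * (T * (\<sigma> * u\<^sup>2 * y))"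
    by (simp add: y_def algebra_simps power2_eq_square)
  moreover have "\<sigma> * (u + T * u\<^sup>2 + \<zeta>) \<le> \<sigma> * R"
    using R z by (intro mult_left_mono) (auto simp: \<sigma>)
  \<comment> \<open>Balance of the choice \<open>\<sigma> = \<zeta> / 8\<close>: the linear gain is
    \<open>\<sigma> * \<zeta>\<close>, and the logarithm and the fraction each lose at most twice
    the square of \<open>\<sigma>\<close>.\<close>
  moreover have "\<sigma> * \<zeta> - 4 * \<sigma>\<^sup>2 = \<zeta>\<^sup>2 / 16"
    by (simp add: \<sigma> power2_eq_square)
  ultimately show ?thesis
    unfolding ln using y2 by (simp add: algebra_simps y_def)
qed

lemma tilt_increase_exponent:
  fixes u T R \<zeta> \<sigma> :: real
  assumes u: "0 < u" "u \<le> 1" and T: "0 \<le> T" "T \<le> 1" and z: "0 < \<zeta>" "\<zeta> \<le> 1"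
    and R: "R \<le> u + T * u\<^sup>2 + 2 * \<zeta>" and \<sigma>: "\<sigma> = \<zeta> / 8"
  shows "(1 / u - 1 + \<sigma>) * R - ln (1 / u + \<sigma>) - T * (1 / u - 1 + \<sigma>) / (1 / u + \<sigma>) - 3 * \<sigma> * \<zeta>
    \<le> (1 / u - 1) * R + ln u - (1 - u) * T - \<zeta>\<^sup>2 / 16"
proof -
  define y where "y = \<sigma> * u"
  have y: "0 \<le> y" "y \<le> 1 / 8"
    using u z mult_mono[of \<sigma> "1/8" u 1] by (auto simp: y_def \<sigma>)
  have y2: "y\<^sup>2 \<le> \<sigma>\<^sup>2" "T * (\<sigma> * u\<^sup>2 * y) \<le> \<sigma>\<^sup>2"
    using tilt_square_bounds[of u T \<sigma>] u T z by (simp_all add: y_def \<sigma>)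
  have e1: "1 / u + \<sigma> = (1 + y) / u" using u by (simp add: y_def field_simps)
  have ln: "ln (1 / u + \<sigma>) = ln (1 + y) - ln u"
    unfolding e1 using u y by (simp add: ln_div)
  have "y - y\<^sup>2 \<le> ln (1 + y)"
    using y by (intro ln_one_plus_pos_lower_bound) auto
  moreover have "T * (1 / u - 1 + \<sigma>) / (1 / u + \<sigma>) = T - T * u * (1 / (1 + y))"
  proof -
    have "T * (1 / u - 1 + \<sigma>) = T * (1 / u + \<sigma>) - T" by (simp add: algebra_simps)
    moreover have "1 / u + \<sigma> \<noteq> 0" unfolding e1 using u y by simp
    ultimately have "T * (1 / u - 1 + \<sigma>) / (1 / u + \<sigma>) = T - T / (1 / u + \<sigma>)"
      by (simp add: diff_divide_distrib)
    then show ?thesis unfolding e1 by simp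
  qed
  moreover have "T * u * (1 / (1 + y)) \<le> T * u * (1 - y + y * y)"
  proof (intro mult_left_mono)
    have "0 \<le> y * y * y" using y by simp
    then have "1 \<le> (1 - y + y * y) * (1 + y)"
      by (simp add: algebra_simps)
    then show "1 / (1 + y) \<le> 1 - y + y * y"
      using y by (subst pos_divide_le_eq) auto
  qed (use T u in auto)
  moreover have "T * u * (1 - y + y * y) = T * u - \<sigma> * (T * u\<^sup>2) + T * (\<sigma> * u\<^sup>2 * y)"
    by (simp add: y_def algebra_simps power2_eq_square)
  moreover have "\<sigma> * R \<le> \<sigma> * (u + T * u\<^sup>2 + 2 * \<zeta>)"
    using R z by (intro mult_left_mono) (auto simp: \<sigma>)
  \<comment> \<open>The subtracted \<open>3 * \<sigma> * \<zeta>\<close> belongs to the inner edge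
    \<open>R - 3 * \<zeta>\<close> of the shell. As \<open>R\<close> exceeds the tilted mean by at
    most \<open>2 * \<zeta>\<close>, a gain of \<open>\<sigma> * \<zeta>\<close> remains.\<close>
  moreover have "\<sigma> * \<zeta> - 2 * \<sigma>\<^sup>2 \<ge> \<zeta>\<^sup>2 / 16"
    by (simp add: \<sigma> power2_eq_square)
  ultimately show ?thesis
    unfolding ln using y2 by (simp add: algebra_simps y_def)
qed

section \<open>Chernoff bounds for shells and balls\<close>

text \<open>Under the tilted weight of total mass \<open>W\<close>, the regions outside and inside
  the shell each carry at most \<open>W * E\<close>. The remaining mass lies on the shell, where the
  weight is at most \<open>K\<close>; division by \<open>K\<close> returns to the Gaussian
  measure.\<close>

lemma shell_measure_ge:
  assumes x: "x \<in> space (lebesgue_PiM d)" and T: "(L2_set x {..<d})\<^sup>2 = T * real d" "0 \<le> T" "T \<le> 1"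
    and u: "0 < u" "u \<le> 1" and z: "0 < \<zeta>" "\<zeta> \<le> 1"
    and R: "u + T * u\<^sup>2 + \<zeta> \<le> R" "R \<le> u + T * u\<^sup>2 + 2 * \<zeta>"
  shows "exp (real d / 2 * ((1 / u - 1) * (R - 3 * \<zeta>) + ln u - (1 - u) * T)) * (1 - 2 * exp (- \<zeta>\<^sup>2 * real d / 32))
    \<le> measure (gauss_measure d) {z \<in> space (lebesgue_PiM d).
         (R - 3 * \<zeta>) * real d \<le> (euclid_dist d x z)\<^sup>2 \<and> (euclid_dist d x z)\<^sup>2 < R * real d}"
    (is "_ \<le> measure _ ?S")
proof -
  interpret prob_space "gauss_measure d" by (rule prob_space_gauss_measure)
  define k where "k = 1 / u - 1"
  define \<sigma> where "\<sigma> = \<zeta> / 8"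
  define W where "W = exp (real d / 2 * (k * R + ln u - (1 - u) * T))"
  define E where "E = exp (- \<zeta>\<^sup>2 * real d / 32)"
  \<comment> \<open>The weight \<open>?f k\<close> at the inner edge, which bounds it on the shell
    because \<open>k \<ge> 0\<close>.\<close>
  define K where "K = exp (3 * k * \<zeta> * real d / 2)"
  have k: "k \<ge> 0" using u by (simp add: k_def)
  have \<sigma>: "\<sigma> > 0" "\<sigma> \<le> 1 / 8" using z by (auto simp: \<sigma>_def)
  have iu: "1 / u \<ge> 1" using u by simp
  let ?f = "\<lambda>k z. exp (k * (R * real d - (euclid_dist d x z)\<^sup>2) / 2)"
  let ?c = "exp (- (3 * \<sigma> * \<zeta> * real d / 2))"
  have S [measurable]: "?S \<in> sets (lebesgue_PiM d)" by measurable
  have fm: "(\<lambda>z. ennreal (?f k z)) \<in> borel_measurable (gauss_measure d)" for k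
    by simp
  have W: "(\<integral>\<^sup>+z. ennreal (?f k z) \<partial>gauss_measure d) = ennreal W"
  proof -
    have "- ln (1 + k) = ln u" using u by (simp add: k_def ln_div)
    moreover have "T * k / (1 + k) = (1 - u) * T" using u by (simp add: k_def field_simps)
    ultimately show ?thesis
      using gauss_chernoff_dist[OF _ T(1), of k R] k unfolding W_def by simp
  qed
  have lo: "(\<integral>\<^sup>+z. ennreal (?f (k - \<sigma>) z) \<partial>gauss_measure d) \<le> ennreal (W * E)"
  proof -
    have "k * R - \<sigma> * R - ln (1 / u - \<sigma>) - T * (k - \<sigma>) / (1 / u - \<sigma>)
      \<le> k * R + ln u - (1 - u) * T - \<zeta>\<^sup>2 / 16"
      using tilt_decrease_exponent[OF u T(2,3) z R(1) \<sigma>_def] by (simp add: k_def algebra_simps)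
    from mult_left_mono[OF this, of "real d / 2"]
    have "exp (real d / 2 * (k * R - \<sigma> * R - ln (1 / u - \<sigma>) - T * (k - \<sigma>) / (1 / u - \<sigma>)))
      \<le> exp (real d / 2 * (k * R + ln u - (1 - u) * T - \<zeta>\<^sup>2 / 16))" by simp
    also have "\<dots> = W * E"
      unfolding W_def E_def exp_add[symmetric] by (simp add: algebra_simps)
    finally have "exp (real d / 2 * (k * R - \<sigma> * R - ln (1 / u - \<sigma>) - T * (k - \<sigma>) / (1 / u - \<sigma>))) \<le> W * E" .
    from ennreal_leI[OF this] show ?thesis
      using gauss_chernoff_dist[OF _ T(1), of "k - \<sigma>" R] iu \<sigma>
      by (simp add: k_def left_diff_distrib)
  qed
  have hi: "ennreal ?c * (\<integral>\<^sup>+z. ennreal (?f (k + \<sigma>) z) \<partial>gauss_measure d) \<le> ennreal (W * E)"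
  proof -
    have "k * R + \<sigma> * R - ln (1 / u + \<sigma>) - T * (k + \<sigma>) / (1 / u + \<sigma>) - 3 * \<sigma> * \<zeta>
      \<le> k * R + ln u - (1 - u) * T - \<zeta>\<^sup>2 / 16"
      using tilt_increase_exponent[OF u T(2,3) z R(2) \<sigma>_def] by (simp add: k_def algebra_simps)
    from mult_left_mono[OF this, of "real d / 2"]
    have "exp (real d / 2 * (k * R + \<sigma> * R - ln (1 / u + \<sigma>) - T * (k + \<sigma>) / (1 / u + \<sigma>) - 3 * \<sigma> * \<zeta>))
      \<le> exp (real d / 2 * (k * R + ln u - (1 - u) * T - \<zeta>\<^sup>2 / 16))" by simp
    also have "\<dots> = W * E"
      unfolding W_def E_def exp_add[symmetric] by (simp add: algebra_simps)
    also have "exp (real d / 2 * (k * R + \<sigma> * R - ln (1 / u + \<sigma>) - T * (k + \<sigma>) / (1 / u + \<sigma>) - 3 * \<sigma> * \<zeta>))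
      = ?c * exp (real d / 2 * (k * R + \<sigma> * R - ln (1 / u + \<sigma>) - T * (k + \<sigma>) / (1 / u + \<sigma>)))"
      unfolding exp_add[symmetric] by (simp add: algebra_simps)
    finally have "ennreal (?c * exp (real d / 2 * (k * R + \<sigma> * R - ln (1 / u + \<sigma>) - T * (k + \<sigma>) / (1 / u + \<sigma>))))
      \<le> ennreal (W * E)" by (rule ennreal_leI)
    moreover have "(\<integral>\<^sup>+z. ennreal (?f (k + \<sigma>) z) \<partial>gauss_measure d)
      = ennreal (exp (real d / 2 * (k * R + \<sigma> * R - ln (1 / u + \<sigma>) - T * (k + \<sigma>) / (1 / u + \<sigma>))))"
      using gauss_chernoff_dist[OF _ T(1), of "k + \<sigma>" R] iu \<sigma>
      by (simp add: k_def distrib_right)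
    ultimately show ?thesis by (simp add: ennreal_mult)
  qed
  \<comment> \<open>Outside the ball, lowering the tilt by \<open>\<sigma>\<close> does not decrease
    the weight. Inside the inner edge, raising it by \<open>\<sigma>\<close> gains more than the
    factor \<open>?c\<close> takes away.\<close>
  have pw: "?f k z \<le> K * indicator ?S z + ?f (k - \<sigma>) z + ?c * ?f (k + \<sigma>) z"
    if "z \<in> space (lebesgue_PiM d)" for z
  proof -
    let ?D = "R * real d - (euclid_dist d x z)\<^sup>2"
    have nn: "0 \<le> K * indicator ?S z" "0 \<le> ?f (k - \<sigma>) z" "0 \<le> ?c * ?f (k + \<sigma>) z"
      by (simp_all add: K_def)
    consider "?D \<le> 0" | "?D > 3 * \<zeta> * real d" | "0 < ?D" "?D \<le> 3 * \<zeta> * real d" by linarith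
    then show ?thesis
    proof cases
      case 1
      then have "\<sigma> * ?D \<le> 0" using \<sigma> by (simp add: mult_nonneg_nonpos)
      then have "?f k z \<le> ?f (k - \<sigma>) z" by (simp add: left_diff_distrib)
      then show ?thesis using nn by linarith
    next
      case 2
      then have "\<sigma> * (3 * \<zeta> * real d) \<le> \<sigma> * ?D" using \<sigma> by (intro mult_left_mono) auto
      then have "k * ?D / 2 \<le> - (3 * \<sigma> * \<zeta> * real d / 2) + (k + \<sigma>) * ?D / 2"
        by (simp add: distrib_right add_divide_distrib)
      then have "?f k z \<le> ?c * ?f (k + \<sigma>) z" by (simp only: exp_add[symmetric] exp_le_cancel_iff)
      then show ?thesis using nn by linarith
    next
      case 3
      then have "k * ?D \<le> k * (3 * \<zeta> * real d)" using k by (intro mult_left_mono) auto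
      then have "k * ?D / 2 \<le> 3 * k * \<zeta> * real d / 2" by simp
      then have "?f k z \<le> K" unfolding K_def by (simp only: exp_le_cancel_iff)
      moreover have "z \<in> ?S" using 3 that by (simp add: left_diff_distrib)
      then have "K * indicator ?S z = K" by simp
      ultimately show ?thesis using nn by linarith
    qed
  qed
  have "ennreal W \<le> (\<integral>\<^sup>+z. ennreal K * indicator ?S z + (ennreal (?f (k - \<sigma>) z) + ennreal ?c * ennreal (?f (k + \<sigma>) z)) \<partial>gauss_measure d)"
    unfolding W[symmetric]
  proof (rule nn_integral_mono)
    fix z assume "z \<in> space (gauss_measure d)"
    then have "z \<in> space (lebesgue_PiM d)" by (simp add: space_gauss_measure space_PiM)
    from ennreal_leI[OF pw[OF this]]
    show "ennreal (?f k z) \<le> ennreal K * indicator ?S z + (ennreal (?f (k - \<sigma>) z) + ennreal ?c * ennreal (?f (k + \<sigma>) z))"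
      by (simp add: ennreal_plus ennreal_mult K_def ennreal_indicator add.assoc)
  qed
  also have "\<dots> = ennreal K * emeasure (gauss_measure d) ?S + ((\<integral>\<^sup>+z. ennreal (?f (k - \<sigma>) z) \<partial>gauss_measure d)
      + ennreal ?c * (\<integral>\<^sup>+z. ennreal (?f (k + \<sigma>) z) \<partial>gauss_measure d))"
    using fm S by (simp add: nn_integral_add nn_integral_cmult nn_integral_cmult_indicator)
  also have "\<dots> \<le> ennreal K * emeasure (gauss_measure d) ?S + (ennreal (W * E) + ennreal (W * E))"
    by (intro add_left_mono add_mono lo hi)
  also have "\<dots> = ennreal (K * measure (gauss_measure d) ?S + (W * E + W * E))"
  proof -
    have "0 \<le> K" "0 \<le> W * E" "0 \<le> K * measure (gauss_measure d) ?S"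
      by (simp_all add: K_def W_def E_def)
    then show ?thesis
      unfolding emeasure_eq_measure by (simp only: ennreal_mult' ennreal_plus add_nonneg_nonneg)
  qed
  finally have le: "ennreal W \<le> ennreal (K * measure (gauss_measure d) ?S + (W * E + W * E))" .
  have "0 \<le> K * measure (gauss_measure d) ?S + (W * E + W * E)"
    by (simp add: K_def W_def E_def)
  with le have "W \<le> K * measure (gauss_measure d) ?S + (W * E + W * E)"
    by (simp only: ennreal_le_iff)
  then have "W * (1 - 2 * E) \<le> K * measure (gauss_measure d) ?S"
    by (simp add: algebra_simps)
  moreover have "K > 0" by (simp add: K_def)
  ultimately have "W * (1 - 2 * E) / K \<le> measure (gauss_measure d) ?S"
    by (simp only: pos_divide_le_eq mult.commute)
  then have "inverse K * W * (1 - 2 * E) \<le> measure (gauss_measure d) ?S"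
    by (simp only: divide_inverse mult_ac)
  moreover have "inverse K * W = exp (real d / 2 * ((1 / u - 1) * (R - 3 * \<zeta>) + ln u - (1 - u) * T))"
    unfolding K_def W_def k_def[symmetric] exp_minus[symmetric] exp_add[symmetric]
    by (simp add: algebra_simps)
  ultimately show ?thesis by (simp add: E_def)
qed

text \<open>A Chernoff bound with two tilts: \<open>k\<close> enforces closeness to
  \<open>x\<close>, \<open>l\<close> a large norm. Under the first tilt the mean of the squared norm
  per coordinate is \<open>u + T * (1 - u)^2\<close>; lying \<open>s\<close> above it gains
  \<open>s^2 / 16\<close> over the exponent of the ball.\<close>

lemma outer_part_measure_le:
  assumes x: "x \<in> space (lebesgue_PiM d)" and T: "(L2_set x {..<d})\<^sup>2 = T * real d" "0 \<le> T" "T \<le> 1"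
    and u: "0 < u" "u \<le> 1" and s: "0 < s" "s \<le> 1" and \<rho>: "u + T * (1 - u)\<^sup>2 + s \<le> \<rho>"
  shows "measure (gauss_measure d) {z \<in> space (lebesgue_PiM d).
       (euclid_dist d x z)\<^sup>2 < R * real d \<and> \<rho> * real d \<le> (L2_set z {..<d})\<^sup>2}
    \<le> exp (real d / 2 * ((1 / u - 1) * R + ln u - (1 - u) * T - s\<^sup>2 / 16))" (is "measure _ ?S \<le> _")
proof -
  interpret prob_space "gauss_measure d" by (rule prob_space_gauss_measure)
  define k where "k = 1 / u - 1"
  \<comment> \<open>The linear gain \<open>l * s\<close> exceeds the second-order errors, at most
    \<open>4 * l^2\<close>, by \<open>s^2 / 16\<close>.\<close>
  define l where "l = s / 8"
  define y where "y = l * u"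
  have k: "k \<ge> 0" using u by (simp add: k_def)
  have l: "l > 0" "l \<le> 1 / 8" using s by (auto simp: l_def)
  have y: "0 \<le> y" "y \<le> 1 / 8"
    using u l mult_mono[of l "1/8" u 1] by (auto simp: y_def)
  have m: "1 - l + k = (1 - y) / u" using u by (simp add: k_def y_def field_simps)
  have m0: "1 - l + k > 0" unfolding m using u y by simp
  have S [measurable]: "?S \<in> sets (lebesgue_PiM d)" by measurable
  have pw: "indicator ?S z \<le> exp ((k * R - l * \<rho>) * real d / 2) * exp ((l * (L2_set z {..<d})\<^sup>2 - k * (euclid_dist d x z)\<^sup>2) / 2)" for z
  proof (cases "z \<in> ?S")
    case True
    have "0 \<le> l * ((L2_set z {..<d})\<^sup>2 - \<rho> * real d)" "0 \<le> k * (R * real d - (euclid_dist d x z)\<^sup>2)"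
      using True k l by auto
    then have "0 \<le> (k * R - l * \<rho>) * real d / 2 + (l * (L2_set z {..<d})\<^sup>2 - k * (euclid_dist d x z)\<^sup>2) / 2"
      by (simp add: algebra_simps add_divide_distrib diff_divide_distrib)
    then show ?thesis unfolding exp_add[symmetric] using True by simp
  qed simp
  have "emeasure (gauss_measure d) ?S = (\<integral>\<^sup>+z. ennreal (indicator ?S z) \<partial>gauss_measure d)"
    by (simp add: ennreal_indicator)
  also have "\<dots> \<le> (\<integral>\<^sup>+z. ennreal (exp ((k * R - l * \<rho>) * real d / 2)) *
      ennreal (exp ((l * (L2_set z {..<d})\<^sup>2 - k * (euclid_dist d x z)\<^sup>2) / 2)) \<partial>gauss_measure d)"
    by (intro nn_integral_mono, subst ennreal_mult[symmetric]) (auto intro!: ennreal_leI pw)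
  also have "\<dots> = ennreal (exp ((k * R - l * \<rho>) * real d / 2)) *
      ennreal ((1 - l + k) powr (- real d / 2) * exp ((k\<^sup>2 / (1 - l + k) - k) / 2 * (T * real d)))"
    by (subst nn_integral_cmult) (simp_all add: gauss_chernoff[OF m0] T)
  also have "\<dots> = ennreal (exp (real d / 2 * (k * R - l * \<rho> - ln (1 - l + k) + T * (k\<^sup>2 / (1 - l + k) - k))))"
    using m0 by (subst ennreal_mult[symmetric])
      (auto simp: powr_def exp_add[symmetric] intro!: arg_cong[where f=ennreal] simp: field_simps)
  also have "\<dots> \<le> ennreal (exp (real d / 2 * (k * R + ln u - (1 - u) * T - s\<^sup>2 / 16)))"
  proof (intro ennreal_leI, subst exp_le_cancel_iff, rule mult_left_mono)
    have ln: "ln (1 - l + k) = ln (1 - y) - ln u"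
      unfolding m using u y by (simp add: ln_div)
    have "- y - 2 * y\<^sup>2 \<le> ln (1 - y)"
      using y by (intro ln_one_minus_pos_lower_bound) auto
    moreover have "k\<^sup>2 / (1 - l + k) - k = (1 - u)\<^sup>2 * l * (1 / (1 - y)) - (1 - u)"
    proof -
      have k2: "k = (1 - u) / u" using u by (simp add: k_def field_simps)
      have "k\<^sup>2 / (1 - l + k) = (1 - u)\<^sup>2 / u * (1 / (1 - y))"
        unfolding m unfolding k2 using u y by (simp add: power2_eq_square)
      also have "1 / (1 - y) = 1 + l * u * (1 / (1 - y))"
        using y by (simp add: y_def[symmetric] field_simps)
      also have "(1 - u)\<^sup>2 / u * (1 + l * u * (1 / (1 - y))) = (1 - u)\<^sup>2 / u + (1 - u)\<^sup>2 * l * (1 / (1 - y))"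
        using u by (simp add: distrib_left)
      also have "(1 - u)\<^sup>2 / u = k - (1 - u)"
        unfolding k_def using u by (simp add: field_simps power2_eq_square)
      finally show ?thesis by simp
    qed
    then have "T * (k\<^sup>2 / (1 - l + k) - k) = T * (1 - u)\<^sup>2 * l * (1 / (1 - y)) - T * (1 - u)"
      by (simp only: right_diff_distrib mult.assoc)
    moreover have "T * (1 - u)\<^sup>2 * l * (1 / (1 - y)) \<le> T * (1 - u)\<^sup>2 * l * (1 + 2 * y)"
      using inverse_one_minus_le[of y] y T l by (intro mult_left_mono) auto
    moreover have "y\<^sup>2 \<le> l\<^sup>2" using u l by (auto simp: y_def intro!: power_mono mult_left_le)
    moreover have "T * (1 - u)\<^sup>2 * l * y \<le> l\<^sup>2"
    proof -
      have "T * (1 - u)\<^sup>2 * u \<le> 1 * 1 * 1" using T u by (intro mult_mono power_le_one) auto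
      then have "l\<^sup>2 * (T * (1 - u)\<^sup>2 * u) \<le> l\<^sup>2 * 1" by (intro mult_left_mono) auto
      then show ?thesis by (simp add: y_def power2_eq_square mult_ac)
    qed
    moreover have "l * (u + T * (1 - u)\<^sup>2 + s) \<le> l * \<rho>"
      using \<rho> l by (intro mult_left_mono) auto
    then have "y + T * (1 - u)\<^sup>2 * l + l * s \<le> l * \<rho>"
      by (simp add: y_def distrib_left mult_ac)
    moreover have "T * (1 - u)\<^sup>2 * l * (1 + 2 * y) = T * (1 - u)\<^sup>2 * l + 2 * (T * (1 - u)\<^sup>2 * l * y)"
      by (simp add: distrib_left)
    moreover have "l * s - 4 * l\<^sup>2 = s\<^sup>2 / 16"
      by (simp add: l_def power2_eq_square)
    moreover have "T * (1 - u) = (1 - u) * T" by simp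
    ultimately show "k * R - l * \<rho> - ln (1 - l + k) + T * (k\<^sup>2 / (1 - l + k) - k)
      \<le> k * R + ln u - (1 - u) * T - s\<^sup>2 / 16"
      unfolding ln by linarith
  qed simp
  finally show ?thesis
    unfolding k_def by (simp add: emeasure_eq_measure)
qed

lemma centred_ball_measure_le:
  assumes \<rho>: "0 < \<rho>" "\<rho> \<le> 1"
  shows "measure (gauss_measure d) {z \<in> space (lebesgue_PiM d). (L2_set z {..<d})\<^sup>2 < \<rho> * real d}
    \<le> exp (real d / 2 * (1 - \<rho> + ln \<rho>))" (is "measure _ ?S \<le> _")
proof -
  interpret prob_space "gauss_measure d" by (rule prob_space_gauss_measure)
  \<comment> \<open>The minimiser of the exponent \<open>k * \<rho> - ln (1 + k)\<close>; it is
    nonnegative because \<open>\<rho> \<le> 1\<close>, so the weight is at least 1 on the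
    ball.\<close>
  define k where "k = 1 / \<rho> - 1"
  have k: "k \<ge> 0" "1 + k > 0" using \<rho> by (auto simp: k_def)
  have S [measurable]: "?S \<in> sets (lebesgue_PiM d)" by measurable
  have "emeasure (gauss_measure d) ?S = (\<integral>\<^sup>+z. ennreal (indicator ?S z) \<partial>gauss_measure d)"
    by (simp add: ennreal_indicator)
  also have "\<dots> \<le> (\<integral>\<^sup>+z. ennreal (exp (k * (\<rho> * real d - (euclid_dist d (origin d) z)\<^sup>2) / 2)) \<partial>gauss_measure d)"
    unfolding euclid_dist_origin using k by (intro nn_integral_mono ennreal_leI) (auto simp: indicator_def)
  also have "\<dots> = ennreal (exp (real d / 2 * (k * \<rho> - ln (1 + k))))"
    using gauss_chernoff_dist[OF k(2) L2_set_origin_sq, where R = \<rho>] by simp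
  also have "k * \<rho> - ln (1 + k) = 1 - \<rho> + ln \<rho>"
    using \<rho> by (simp add: k_def ln_div left_diff_distrib)
  finally show ?thesis by (simp add: emeasure_eq_measure)
qed

section \<open>Decay in the dimension and the numerical parameters\<close>

lemma exp_decay_eventually:
  fixes c e :: real
  assumes "c > 0" "e > 0"
  shows "eventually (\<lambda>d::nat. exp (- c * real d) \<le> e) sequentially"
proof -
  have "(\<lambda>d. exp (- c) ^ d) \<longlonglongrightarrow> 0"
    using assms by (intro LIMSEQ_realpow_zero) auto
  then have "(\<lambda>d. exp (- c * real d)) \<longlonglongrightarrow> 0"
    by (simp add: exp_of_nat_mult[symmetric] mult.commute)
  from order_tendstoD(2)[OF this assms(2)] show ?thesis
    by eventually_elim simp
qed

text \<open>The numerical inequality is bounded through \<open>(1 - x/32)\<^sup>3\<^sup>2 \<le> exp (- x)\<close>, the power being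
  computed by repeated squaring with rounding to eight decimals.\<close>

lemma rate_gap:
  "(9226 / 10000 :: real) \<le> u \<Longrightarrow> u \<le> 9228 / 10000 \<Longrightarrow>
     1 - 7366 / 10000 + ln (7366 / 10000) + 2 * ln (1019 / 1000) + 1 / 2000
       \<le> 1 - u - 1 / 1000000 + ln u"
proof -
  assume u: "9226 / 10000 \<le> u" "u \<le> 9228 / 10000"
  \<comment> \<open>Each side is taken at its worst end: \<open>?c\<close> uses the smallest
    \<open>u\<close>, while \<open>?x\<close> rounds up
    \<open>u - 7366/10000 + 1/2000 + 1/1000000\<close> at the largest \<open>u\<close>.\<close>
  let ?c = "(9226 / 10000) / ((7366 / 10000) * (1019 / 1000)\<^sup>2) :: real"
  let ?x = "1868 / 10000 :: real"
  define y where "y = 1 - ?x / real 32"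
  have y: "y = 79533 / 80000" by (simp add: y_def)
  have p2: "98835907 / 100000000 \<le> y ^ 2" by (simp add: y power2_eq_square)
  have p4: "97685365 / 100000000 \<le> y ^ 4"
    using power_mono[OF p2, of 2] by (simp add: power_mult[symmetric] power_divide)
  have p8: "95424305 / 100000000 \<le> y ^ 8"
    using power_mono[OF p4, of 2] by (simp add: power_mult[symmetric] power_divide)
  have p16: "91057979 / 100000000 \<le> y ^ 16"
    using power_mono[OF p8, of 2] by (simp add: power_mult[symmetric] power_divide)
  have p32: "82915555 / 100000000 \<le> y ^ 32"
    using power_mono[OF p16, of 2] by (simp add: power_mult[symmetric] power_divide)
  have "(1 - ?x / real 32) ^ 32 \<le> exp (- ?x)"
    by (rule exp_ge_one_minus_x_over_n_power_n) auto
  moreover have "1 / ?c \<le> (1 - ?x / real 32) ^ 32"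
    using p32 unfolding y_def by (simp add: power2_eq_square)
  ultimately have "ln (1 / ?c) \<le> ln (exp (- ?x))"
    by (subst ln_le_cancel_iff) auto
  then have "?x \<le> ln ?c" by (simp add: ln_div)
  also have "ln ?c = ln (9226 / 10000) - ln (7366 / 10000) - 2 * ln (1019 / 1000)"
    by (simp add: ln_div ln_mult ln_realpow)
  finally have "?x \<le> ln u - ln (7366 / 10000) - 2 * ln (1019 / 1000)"
    using u ln_mono[of "9226 / 10000" u] by linarith
  then show ?thesis using u by simp
qed

text \<open>With \<open>u = 51/100\<close> the mean \<open>u + T u\<^sup>2\<close> equals \<open>3/4\<close> for \<open>T = (24/100) / u\<^sup>2\<close>, and then the tilted
  Gaussian has mean squared norm \<open>(u + T (1 - u)\<^sup>2) d\<close>, slightly below \<open>7366/10000 d\<close>. A shell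
  level \<open>T < 1\<close> (about \<open>0.9227\<close>) gives a larger rate than the shell \<open>\<parallel>x\<parallel>\<^sup>2 \<approx> d\<close>.\<close>

definition shell_width :: real where
  "shell_width = 1 / 5000000"

definition shell_level :: real where
  "shell_level = (24 / 100 - 6 / 5 * shell_width) / (2601 / 10000)"

definition thin_shell :: "nat \<Rightarrow> (nat \<Rightarrow> real) set" where
  "thin_shell d = {z \<in> space (lebesgue_PiM d).
     (shell_level - 3 / 2 * shell_width) * real d \<le> (L2_set z {..<d})\<^sup>2 \<and> (L2_set z {..<d})\<^sup>2 < shell_level * real d}"

definition core_ball :: "nat \<Rightarrow> (nat \<Rightarrow> real) set" where
  "core_ball d = {z \<in> space (lebesgue_PiM d). (L2_set z {..<d})\<^sup>2 < 7366 / 10000 * real d}"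

lemma thin_shell_measurable [measurable]: "thin_shell d \<in> sets (lebesgue_PiM d)"
  unfolding thin_shell_def by measurable

lemma core_ball_measurable [measurable]: "core_ball d \<in> sets (lebesgue_PiM d)"
  unfolding core_ball_def by measurable

section \<open>The test shell and the test ball\<close>

text \<open>The exponent is the rate bounding \<open>core_ball\<close> from above, plus
  \<open>2 * ln (1019 / 1000)\<close> for the factor \<open>1.019 ^ d\<close>, plus a margin
  \<open>1 / 2000\<close> that later pays for constants.\<close>

lemma thin_shell_measure_ge:
  "\<forall>\<^sub>F d in sequentially. exp (real d / 2 * (1 - 7366 / 10000 + ln (7366 / 10000) + 2 * ln (1019 / 1000) + 1 / 2000)) / 2
     \<le> measure (gauss_measure d) (thin_shell d)"
proof -
  \<comment> \<open>The general estimate produces shells of thickness \<open>3 * z\<close>, here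
    \<open>3 / 2 * shell_width\<close>.\<close>
  define z where "z = shell_width / 2"
  \<comment> \<open>About the origin \<open>T = 0\<close> and the tilted mean is \<open>u\<close>,
    so \<open>shell_level\<close> sits midway between \<open>u + z\<close> and
    \<open>u + 2 * z\<close>.\<close>
  define u where "u = shell_level - 3 / 2 * z"
  have z: "0 < z" "z \<le> 1" by (simp_all add: z_def shell_width_def)
  have u: "9226 / 10000 \<le> u" "u \<le> 9228 / 10000"
    by (simp_all add: u_def z_def shell_level_def shell_width_def)
  have "\<forall>\<^sub>F d in sequentially. exp (- (z\<^sup>2 / 32) * real d) \<le> 1 / 4"
    using z by (intro exp_decay_eventually) auto
  then show ?thesis
  proof eventually_elim
    case (elim d)
    have d: "exp (- z\<^sup>2 * real d / 32) \<le> 1 / 4" using elim by simp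
    have "(1 / u - 1) * (shell_level - 3 * z) \<ge> 1 - u - 1 / 1000000"
    proof -
      have "1 / u \<le> 2" using u by (simp add: divide_le_eq)
      then have "3 / 2 * z * (1 / u - 1) \<le> 3 / 2 * z * 1" using z by (intro mult_left_mono) auto
      moreover have "(1 / u - 1) * (shell_level - 3 * z) = 1 - u - 3 / 2 * z * (1 / u - 1)"
        using u by (simp add: u_def[symmetric] field_simps) (simp add: u_def algebra_simps)
      ultimately show ?thesis by (simp add: z_def shell_width_def)
    qed
    then have "1 - 7366 / 10000 + ln (7366 / 10000) + 2 * ln (1019 / 1000) + 1 / 2000
       \<le> (1 / u - 1) * (shell_level - 3 * z) + ln u - (1 - u) * 0"
      using rate_gap[OF u] by simp
    then have "exp (real d / 2 * (1 - 7366 / 10000 + ln (7366 / 10000) + 2 * ln (1019 / 1000) + 1 / 2000)) * (1 / 2)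
       \<le> exp (real d / 2 * ((1 / u - 1) * (shell_level - 3 * z) + ln u - (1 - u) * 0)) * (1 - 2 * exp (- z\<^sup>2 * real d / 32))"
      using d by (intro mult_mono exp_le_cancel_iff[THEN iffD2] mult_left_mono) auto
    also have "\<dots> \<le> measure (gauss_measure d) {w \<in> space (lebesgue_PiM d).
         (shell_level - 3 * z) * real d \<le> (euclid_dist d (origin d) w)\<^sup>2 \<and> (euclid_dist d (origin d) w)\<^sup>2 < shell_level * real d}"
      by (rule shell_measure_ge[OF origin_in_space L2_set_origin_sq]) (use u z in \<open>auto simp: u_def\<close>)
    also have "{w \<in> space (lebesgue_PiM d).
         (shell_level - 3 * z) * real d \<le> (euclid_dist d (origin d) w)\<^sup>2 \<and> (euclid_dist d (origin d) w)\<^sup>2 < shell_level * real d} = thin_shell d"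
      unfolding euclid_dist_origin thin_shell_def z_def by simp
    finally show ?case by simp
  qed
qed

text \<open>The lower bound for the ball about \<open>x\<close> and the upper bound for its part
  outside \<open>core_ball\<close> share the exponent \<open>L\<close>. The former loses
  \<open>3 * z\<close>, the latter gains the larger \<open>s^2 / 16\<close>, so the outside part is
  at most half of the ball.\<close>

lemma averaging_core_ball_ge:
  assumes d: "d \<ge> 40000000" and e1: "exp (- (shell_width\<^sup>2 / 32) * real d) \<le> 1 / 4"
    and e2: "exp (- (1 / 4000000) * real d) \<le> 1 / 4" and x: "x \<in> thin_shell d"
  shows "1 / 2 \<le> gauss_avg d (sqrt (3 * real d - 3) / 2) (indicator (core_ball d)) x"
proof -
  interpret prob_space "gauss_measure d" by (rule prob_space_gauss_measure)
  define z where "z = shell_width"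
  define r where "r = sqrt (3 * real d - 3) / 2"
  define R where "R = 3 / 4 - 3 / (4 * real d)"
  define u :: real where "u = 51 / 100"
  define s :: real where "s = 1 / 200"
  define T where "T = (L2_set x {..<d})\<^sup>2 / real d"
  have d0: "real d > 0" using d by simp
  have xs: "x \<in> space (lebesgue_PiM d)" using x by (simp add: thin_shell_def)
  have r: "r > 0" "r\<^sup>2 = R * real d"
    using d d0 by (simp_all add: r_def R_def power_divide field_simps)
  have z: "0 < z" "z \<le> 1" by (simp_all add: z_def shell_width_def)
  have T: "(L2_set x {..<d})\<^sup>2 = T * real d" using d0 by (simp add: T_def)
  have Tb: "shell_level - 3 / 2 * z \<le> T" "T \<le> shell_level"
    using x d0 by (auto simp: thin_shell_def T z_def)
  then have T01: "0 \<le> T" "T \<le> 1" by (simp_all add: z_def shell_level_def shell_width_def)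
  \<comment> \<open>The threshold on \<open>d\<close> makes the shift
    \<open>3 / (4 * real d)\<close>, due to \<open>3 * real d - 3\<close> in the radius, at most a
    tenth of the width.\<close>
  have R: "3 / 4 - z / 10 \<le> R" "R \<le> 3 / 4"
    using d d0 by (simp_all add: R_def z_def shell_width_def field_simps)
  have iu: "1 / u - 1 = 49 / 51" by (simp add: u_def)
  define L where "L = (1 / u - 1) * R + ln u - (1 - u) * T"
  let ?B = "gball d x r"
  have B: "?B = {y \<in> space (lebesgue_PiM d). (euclid_dist d x y)\<^sup>2 < R * real d}"
    unfolding gball_eq[OF xs] r(2)[symmetric] using r(1) euclid_dist_nonneg[of d x]
    by (auto simp: abs_less_iff intro!: power_strict_mono dest: power_less_imp_less_base[OF _ less_imp_le[OF r(1)]])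
  have Bm [measurable]: "?B \<in> sets (gauss_measure d)" by (simp add: gball_measurable xs)
  have lower: "exp (real d / 2 * (L - 3 * z)) / 2 \<le> measure (gauss_measure d) ?B"
  proof -
    have "exp (real d / 2 * (L - 3 * z)) * (1 / 2)
      \<le> exp (real d / 2 * ((1 / u - 1) * (R - 3 * z) + ln u - (1 - u) * T)) * (1 - 2 * exp (- z\<^sup>2 * real d / 32))"
    proof (rule mult_mono)
      have "L - 3 * z \<le> (1 / u - 1) * (R - 3 * z) + ln u - (1 - u) * T"
      proof -
        have "49 / 51 * (R - 3 * z) = 49 / 51 * R - 147 / 51 * z" by (simp add: right_diff_distrib)
        then show ?thesis unfolding L_def iu using z by linarith
      qed
      then show "exp (real d / 2 * (L - 3 * z)) \<le> exp (real d / 2 * ((1 / u - 1) * (R - 3 * z) + ln u - (1 - u) * T))"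
        unfolding exp_le_cancel_iff by (rule mult_left_mono) simp
      show "1 / 2 \<le> 1 - 2 * exp (- z\<^sup>2 * real d / 32)"
        using e1 by (simp add: z_def)
    qed auto
    also have "\<dots> \<le> measure (gauss_measure d) {w \<in> space (lebesgue_PiM d).
         (R - 3 * z) * real d \<le> (euclid_dist d x w)\<^sup>2 \<and> (euclid_dist d x w)\<^sup>2 < R * real d}"
    proof (rule shell_measure_ge[OF xs T T01 _ _ z])
      \<comment> \<open>The correction \<open>6 / 5 * shell_width\<close> in
        \<open>shell_level\<close> serves this purpose: throughout the thin shell, \<open>R\<close>
        exceeds the tilted mean by between one and two widths.\<close>
      show "u + T * u\<^sup>2 + z \<le> R" "R \<le> u + T * u\<^sup>2 + 2 * z"
        using Tb R by (simp_all add: u_def shell_level_def z_def shell_width_def power2_eq_square)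
    qed (simp_all add: u_def)
    also have "\<dots> \<le> measure (gauss_measure d) ?B"
      by (rule finite_measure_mono[OF _ Bm]) (unfold B, auto)
    finally show ?thesis by simp
  qed
  have "measure (gauss_measure d) (?B - core_ball d) \<le> exp (real d / 2 * (L - s\<^sup>2 / 16))"
  proof -
    have "?B - core_ball d = {w \<in> space (lebesgue_PiM d).
       (euclid_dist d x w)\<^sup>2 < R * real d \<and> 7366 / 10000 * real d \<le> (L2_set w {..<d})\<^sup>2}"
      unfolding B core_ball_def by auto
    also have "measure (gauss_measure d) \<dots> \<le> exp (real d / 2 * (L - s\<^sup>2 / 16))"
      unfolding L_def
    proof (rule outer_part_measure_le[OF xs T T01])
      show "u + T * (1 - u)\<^sup>2 + s \<le> 7366 / 10000"
        using Tb by (simp add: u_def s_def shell_level_def shell_width_def power2_eq_square)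
    qed (simp_all add: u_def s_def)
    finally show ?thesis .
  qed
  \<comment> \<open>Half the difference of \<open>s^2 / 16\<close> and \<open>3 * z\<close> is at
    least \<open>1 / 4000000\<close>.\<close>
  also have "\<dots> \<le> exp (real d / 2 * (L - 3 * z)) * exp (- (1 / 4000000) * real d)"
    unfolding exp_add[symmetric] exp_le_cancel_iff
    by (simp add: s_def z_def shell_width_def power2_eq_square algebra_simps)
  also have "\<dots> \<le> exp (real d / 2 * (L - 3 * z)) * (1 / 4)"
    by (intro mult_left_mono e2) auto
  also have "\<dots> \<le> measure (gauss_measure d) ?B / 2"
    using lower by simp
  finally have half: "measure (gauss_measure d) (?B - core_ball d) \<le> measure (gauss_measure d) ?B / 2" .
  have "measure (gauss_measure d) (?B - core_ball d) = measure (gauss_measure d) ?B - measure (gauss_measure d) (?B \<inter> core_ball d)"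
    by (rule finite_measure_Diff') (auto simp: gball_measurable xs)
  with half have "measure (gauss_measure d) ?B / 2 \<le> measure (gauss_measure d) (?B \<inter> core_ball d)"
    by simp
  moreover have "(LINT y:?B|gauss_measure d. indicator (core_ball d) y) = measure (gauss_measure d) (?B \<inter> core_ball d)"
  proof -
    have m: "?B \<inter> core_ball d \<in> sets (gauss_measure d)"
      using Bm core_ball_measurable by auto
    have "(LINT y:?B|gauss_measure d. indicator (core_ball d) y) = (LINT y|gauss_measure d. indicator (?B \<inter> core_ball d) y)"
      unfolding set_lebesgue_integral_def
      by (intro Bochner_Integration.integral_cong) (auto simp: indicator_def)
    also have "\<dots> = measure (gauss_measure d) (?B \<inter> core_ball d)"
      by (simp add: sets.Int_space_eq2[OF m])
    finally show ?thesis .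
  qed
  moreover have "measure (gauss_measure d) ?B > 0"
    by (rule measure_gball_pos[OF xs r(1)])
  ultimately show ?thesis
    unfolding averaging_def r_def[symmetric] by (simp add: field_simps)
qed

section \<open>From the test sets to the weak type constant\<close>

text \<open>Testing on the indicator of \<open>A\<close> at height 1/2 bounds the measure of
  \<open>S\<close> by \<open>(2 * c) powr p\<close> times that of \<open>A\<close>, so every
  admissible \<open>c\<close> satisfies \<open>q \<le> c powr p\<close>. The gap between
  \<open>b\<close> and \<open>q\<close> keeps the inequality strict for the infimum.\<close>

lemma less_weak_norm:
  assumes q: "0 \<le> b" "b < q" and p: "p \<ge> 1" and A: "A \<in> sets (gauss_measure d)" "measure (gauss_measure d) A > 0"
    and S: "S \<subseteq> space (gauss_measure d)" "S \<in> sets (gauss_measure d)"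
    and avg: "\<And>x. x \<in> S \<Longrightarrow> 1 / 2 \<le> gauss_avg d r (indicator A) x"
    and le: "2 powr p * q * measure (gauss_measure d) A \<le> measure (gauss_measure d) S"
  shows "ennreal (b powr (1 / p)) < weak_norm p (gauss_measure d) (gauss_avg d r)"
proof -
  interpret prob_space "gauss_measure d" by (rule prob_space_gauss_measure)
  let ?g = "indicator A :: _ \<Rightarrow> real"
  let ?\<mu> = "measure (gauss_measure d)"
  have ind: "\<bar>?g y\<bar> powr p = ?g y" "?g y powr p = ?g y" for y by (simp_all add: indicator_def)
  have int: "integrable (gauss_measure d) ?g" "(LINT y|gauss_measure d. ?g y) = ?\<mu> A"
    using A by (simp_all add: sets.Int_space_eq2[OF A(1)] less_top[symmetric])
  have g: "?g \<in> Lp_space p (gauss_measure d)"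
    unfolding Lp_space_def using A int by (simp add: ind)
  have norm: "Lp_norm p (gauss_measure d) ?g = ?\<mu> A powr (1 / p)"
    unfolding Lp_norm_def ind int(2) ..
  have "ennreal (q powr (1 / p)) \<le> ennreal c" if c: "c \<ge> 0"
    and adm: "\<forall>g\<in>Lp_space p (gauss_measure d). \<forall>\<alpha>>0. emeasure (gauss_measure d) {x \<in> space (gauss_measure d). \<alpha> \<le> gauss_avg d r g x}
        \<le> ennreal ((c * Lp_norm p (gauss_measure d) g / \<alpha>) powr p)" for c
  proof -
    have "gauss_avg d r ?g \<in> borel_measurable (gauss_measure d)"
      by (rule averaging_measurable) (use A in simp)
    then have m: "{x \<in> space (gauss_measure d). 1 / 2 \<le> gauss_avg d r ?g x} \<in> sets (gauss_measure d)"
      by (rule borel_measurable_le[OF borel_measurable_const])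
    have "emeasure (gauss_measure d) S \<le> emeasure (gauss_measure d) {x \<in> space (gauss_measure d). 1 / 2 \<le> gauss_avg d r ?g x}"
      using S avg by (intro emeasure_mono m) auto
    also have "\<dots> \<le> ennreal ((c * Lp_norm p (gauss_measure d) ?g / (1 / 2)) powr p)"
      by (rule adm[rule_format, OF g]) simp
    finally have "?\<mu> S \<le> (c * ?\<mu> A powr (1 / p) / (1 / 2)) powr p"
      by (simp add: norm emeasure_eq_measure)
    also have "\<dots> = c powr p * ?\<mu> A * 2 powr p"
      using p by (simp add: powr_mult powr_powr mult_ac)
    finally have "?\<mu> S \<le> 2 powr p * c powr p * ?\<mu> A" by (simp add: mult_ac)
    with le have "2 powr p * q * ?\<mu> A \<le> 2 powr p * c powr p * ?\<mu> A" by linarith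
    then have "q \<le> c powr p" using A by simp
    then have "q powr (1 / p) \<le> (c powr p) powr (1 / p)"
      using q p by (intro powr_mono2) auto
    also have "\<dots> = c" using c p by (simp add: powr_powr)
    finally show ?thesis by (rule ennreal_leI)
  qed
  then have "ennreal (q powr (1 / p)) \<le> weak_norm p (gauss_measure d) (gauss_avg d r)"
    unfolding weak_norm_def by (intro Inf_greatest) auto
  moreover have "ennreal (b powr (1 / p)) < ennreal (q powr (1 / p))"
    using q p by (intro ennreal_lessI powr_less_mono2) auto
  ultimately show ?thesis by (rule less_le_trans[rotated])
qed

lemma weak_norm_gt_eventually:
  assumes p: "(p::real) \<ge> 1"
  shows "\<forall>\<^sub>F d in sequentially. ennreal (1.019 powr (real d / p))
    < weak_norm p (gauss_measure d) (gauss_avg d (sqrt (3 * real d - 3) / 2))"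
proof -
  let ?l = "1 - 7366 / 10000 + ln (7366 / 10000) :: real"
  have "\<forall>\<^sub>F d in sequentially. exp (- (shell_width\<^sup>2 / 32) * real d) \<le> 1 / 4"
    "\<forall>\<^sub>F d in sequentially. exp (- (1 / 4000000) * real d) \<le> 1 / 4"
    "\<forall>\<^sub>F d in sequentially. exp (- (1 / 4000) * real d) \<le> 1 / (4 * 2 powr p)"
    by (intro exp_decay_eventually; simp add: shell_width_def)+
  then show ?thesis
    using eventually_ge_at_top[of "40000000::nat"] thin_shell_measure_ge
  proof eventually_elim
    case (elim d)
    interpret prob_space "gauss_measure d" by (rule prob_space_gauss_measure)
    have sq: "L2_set z {..<d} < sqrt c \<longleftrightarrow> (L2_set z {..<d})\<^sup>2 < c" for z c
      by (metis L2_set_nonneg real_sqrt_abs abs_of_nonneg real_sqrt_less_iff)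
    have "gball d (origin d) (sqrt (7366 / 10000 * real d)) = core_ball d"
      unfolding gball_eq[OF origin_in_space] euclid_dist_origin core_ball_def
      using sq by simp
    then have pos: "measure (gauss_measure d) (core_ball d) > 0"
      using measure_gball_pos[OF origin_in_space, where d = d and r = "sqrt (7366 / 10000 * real d)"] elim(4) by simp
    \<comment> \<open>Here \<open>q\<close> is twice \<open>1.019 powr real d\<close>, which
      provides the strict gap.\<close>
    have "2 powr p * (2 * 1.019 powr real d) * measure (gauss_measure d) (core_ball d)
      \<le> 2 powr p * (2 * 1.019 powr real d) * exp (real d / 2 * ?l)"
      unfolding core_ball_def by (intro mult_left_mono centred_ball_measure_le) auto
    also have "\<dots> = 4 * 2 powr p * (exp (real d / 2 * (?l + 2 * ln (1019 / 1000))) / 2)"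
      by (simp add: powr_def exp_add[symmetric] algebra_simps)
    \<comment> \<open>The margin \<open>1 / 2000\<close> becomes the factor
      \<open>exp (- (1 / 4000) * real d)\<close>, which absorbs \<open>4 * 2 powr p\<close> once
      \<open>d\<close> is large depending on \<open>p\<close>.\<close>
    also have "\<dots> = 4 * 2 powr p * exp (- (1 / 4000) * real d) * (exp (real d / 2 * (?l + 2 * ln (1019 / 1000) + 1 / 2000)) / 2)"
    proof -
      have "exp (- (1 / 4000) * real d) * exp (real d / 2 * (?l + 2 * ln (1019 / 1000) + 1 / 2000))
         = exp (real d / 2 * (?l + 2 * ln (1019 / 1000)))"
        unfolding exp_add[symmetric] by (simp add: algebra_simps)
      then show ?thesis by simp
    qed
    also have "\<dots> \<le> 1 * (exp (real d / 2 * (?l + 2 * ln (1019 / 1000) + 1 / 2000)) / 2)"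
      using elim(3) by (intro mult_right_mono) (auto simp: field_simps)
    also have "\<dots> \<le> measure (gauss_measure d) (thin_shell d)"
      using elim(5) by simp
    finally have main: "2 powr p * (2 * 1.019 powr real d) * measure (gauss_measure d) (core_ball d)
      \<le> measure (gauss_measure d) (thin_shell d)" .
    have "ennreal ((1.019 powr real d) powr (1 / p)) < weak_norm p (gauss_measure d) (gauss_avg d (sqrt (3 * real d - 3) / 2))"
    proof (rule less_weak_norm[OF _ _ p _ pos _ _ _ main])
      show "1 / 2 \<le> gauss_avg d (sqrt (3 * real d - 3) / 2) (indicator (core_ball d)) x" if "x \<in> thin_shell d" for x
        using elim(1,2) by (intro averaging_core_ball_ge elim(4) that) auto
      show "thin_shell d \<subseteq> space (gauss_measure d)"
        by (auto simp: thin_shell_def space_gauss_measure space_PiM)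
    qed auto
    then show ?case by (simp add: powr_powr)
  qed
qed

theorem theorem4p3:
  shows "(\<forall>d\<ge>1. \<forall>r>0. \<not> local_comparability (gauss_measure d) (euclid_dist d) r)
    \<and> (\<forall>d\<ge>1. \<forall>p\<ge>1.
        (SUP r\<in>{0<..}. strong_norm p (gauss_measure d) (gauss_avg d r))
          \<le> ennreal ((2 ^ (d - 1) * sqrt (2 * pi * real d)
              + sqrt (pi * (real d + 1)) * (2 / sqrt 3) ^ (d + 1)) powr (1 / p)))
    \<and> (\<forall>\<epsilon>>0. \<exists>D\<ge>1. \<forall>d\<ge>D. \<forall>p\<ge>1.
        (SUP r\<in>{0<..}. strong_norm p (gauss_measure d) (gauss_avg d r))
          \<le> ennreal ((2 + \<epsilon>) powr (real d / p)))
    \<and> (\<forall>p\<ge>1. \<exists>D\<ge>1. \<forall>d\<ge>D.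
        weak_norm p (gauss_measure d) (gauss_avg d (sqrt (3 * real d - 3) / 2))
          > ennreal (1.019 powr (real d / p)))"
proof (intro conjI allI impI)
  fix p :: real assume "p \<ge> 1"
  from weak_norm_gt_eventually[OF this] obtain N where "\<forall>d\<ge>N. ennreal (1.019 powr (real d / p))
    < weak_norm p (gauss_measure d) (gauss_avg d (sqrt (3 * real d - 3) / 2))"
    unfolding eventually_sequentially by blast
  then show "\<exists>D\<ge>1. \<forall>d\<ge>D. weak_norm p (gauss_measure d) (gauss_avg d (sqrt (3 * real d - 3) / 2))
          > ennreal (1.019 powr (real d / p))"
    by (intro exI[of _ "max 1 N"]) auto
qed (rule not_local_comparability_gauss SUP_strong_norm_le SUP_strong_norm_le_eventually; assumption)+

end
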